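(* Let $w\in S_n$ be a permutation avoiding the pattern $1423$. Then the reduction map $\Phi:\mathrm{MRPD}(w)\to\bigsqcup_{v\le w}\mathrm{CMRPD}(v)$ is a bijection.
   Context: Let $v=v_1\cdots v_m$ be a word of distinct positive integers with sorted entries $a_1<\dots<a_m$. A pipe dream for $v$ fills the staircase $\{(i,k):i+k\le m+1\}$ (row $i$ from top, column $k$ from left) with crossing tiles and bumping tiles (upper-left arc joining top and left edges, lower-right arc joining bottom and right edges), tiles $(i,m+1-i)$ being bumping. Pipe $a_k$ enters at the top of column $k$, travels down/left to the left boundary. Reduced: any two pipes cross at most once and the pipe exiting row $i$ is labelled $v_i$. A marked reduced pipe dream additionally marks some bumping tiles, a bumping tile in row $i$ being markable only if its two pipes cross at a crossing in a row strictly above $i$; $\mathrm{MRPD}(v)$ is the set of these. Pipe $j$ (entering column $C_j$) is removable if (i) column $C_j$ consists of crossings all traversed by pipe $j$ followed only by unmarked bumping tiles; (ii) for each crossing traversed by pipe $j$ the tile directly above (if any) is not an unmarked bumping tile; (iii) pipe $j$ traverses no marked bumping tile. $P$ is core if no pipe is removable; $\mathrm{CMRPD}(v)$ is the set of core elements of $\mathrm{MRPD}(v)$. For removable $j$, in each column $c<C_j$ pipe $j$ traverses either one crossing horizontally or two vertically adjacent unmarked bumping tiles $(r,c),(r+1,c)$ (entering $(r,c)$ from the right, leaving $(r+1,c)$ to the left); $\Phi_j(P)\in\mathrm{MRPD}(v\setminus j)$ deletes column $C_j$, deletes in each column $c<C_j$ that crossing (or the lower-right half of $(r,c)$ and the upper-left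 half of $(r+1,c)$), then shifts tiles right of $C_j$ one unit left and, in columns $c<C_j$, tiles/half-tiles below pipe $j$ one unit up (remaining halves forming one unmarked bumping tile), keeping other tiles and markings. If $P\in\mathrm{MRPD}(w)$ has removable pipes $j_1,\dots,j_k$, then $\Phi(P)=\Phi_{j_k}(\cdots\Phi_{j_1}(P)\cdots)$, which is independent of the order and lies in $\mathrm{CMRPD}(v)$, $v$ being $w$ with $j_1,\dots,j_k$ deleted. The union is over all subwords $v$ of $w$. *)

theory Defs
  imports Main "HOL-Library.Sublist"
begin

text \<open>Tiles of a (marked) pipe dream.  Position (i,k): row i (from the top, starting at 1),
  column k (from the left, starting at 1).  Cross = crossing tile, Bump b = bumping tile,
  marked iff b.\<close>
datatype tile = Cross | Bump bool

datatype dir = FromTop | FromRight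

type_synonym pd = "nat \<times> nat \<Rightarrow> tile"

definition staircase :: "nat \<Rightarrow> (nat \<times> nat) set" where
  "staircase m = {(i,k). 1 \<le> i \<and> 1 \<le> k \<and> i + k \<le> m + 1}"

text \<open>One step of a pipe: at tile (i,k) entered from direction d, where does it go next?
  None means the pipe leaves the left boundary (exits row i).\<close>
fun step :: "pd \<Rightarrow> nat \<times> nat \<times> dir \<Rightarrow> (nat \<times> nat \<times> dir) option" where
  "step P (i,k,d) =
     (case (P (i,k), d) of
        (Cross, FromTop) \<Rightarrow> Some (i+1, k, FromTop)
      | (Cross, FromRight) \<Rightarrow> (if k \<le> 1 then None else Some (i, k-1, FromRight))
      | (Bump _, FromTop) \<Rightarrow> (if k \<le> 1 then None else Some (i, k-1, FromRight))
      | (Bump _, FromRight) \<Rightarrow> Some (i+1, k, FromTop))"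

inductive visits :: "pd \<Rightarrow> nat \<Rightarrow> nat \<times> nat \<times> dir \<Rightarrow> bool" for P :: pd and c :: nat where
  vstart: "visits P c (1, c, FromTop)"
| vstep: "visits P c s \<Longrightarrow> step P s = Some s' \<Longrightarrow> visits P c s'"

definition traverses :: "pd \<Rightarrow> nat \<Rightarrow> nat \<times> nat \<Rightarrow> bool" where
  "traverses P c p \<longleftrightarrow> (\<exists>d. visits P c (fst p, snd p, d))"

definition exits_row :: "pd \<Rightarrow> nat \<Rightarrow> nat \<Rightarrow> bool" where
  "exits_row P c i \<longleftrightarrow> (\<exists>d. visits P c (i, 1, d) \<and> step P (i, 1, d) = None)"

definition is_pipe_dream :: "nat \<Rightarrow> pd \<Rightarrow> bool" where
  "is_pipe_dream m P \<longleftrightarrow>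
     (\<forall>p. p \<notin> staircase m \<longrightarrow> P p = Bump False) \<and>
     (\<forall>i. 1 \<le> i \<and> i \<le> m \<longrightarrow> P (i, m + 1 - i) \<noteq> Cross)"

text \<open>Pipe entering column k carries label a_k = (sort v) ! (k-1).\<close>
definition reduced :: "nat list \<Rightarrow> pd \<Rightarrow> bool" where
  "reduced v P \<longleftrightarrow> is_pipe_dream (length v) P \<and>
     (\<forall>c1 c2 p q. 1 \<le> c1 \<and> c1 \<le> length v \<and> 1 \<le> c2 \<and> c2 \<le> length v \<and> c1 \<noteq> c2 \<and>
        P p = Cross \<and> traverses P c1 p \<and> traverses P c2 p \<and>
        P q = Cross \<and> traverses P c1 q \<and> traverses P c2 q \<longrightarrow> p = q) \<and>
     (\<forall>k i. 1 \<le> k \<and> k \<le> length v \<and> 1 \<le> i \<and> i \<le> length v \<and> v ! (i-1) = sort v ! (k-1)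
        \<longrightarrow> exits_row P k i)"

definition markings_ok :: "nat list \<Rightarrow> pd \<Rightarrow> bool" where
  "markings_ok v P \<longleftrightarrow>
     (\<forall>i k. P (i,k) = Bump True \<longrightarrow>
        (\<exists>c1 c2 i' k'. 1 \<le> c1 \<and> c1 \<le> length v \<and> 1 \<le> c2 \<and> c2 \<le> length v \<and>
           visits P c1 (i, k, FromTop) \<and> visits P c2 (i, k, FromRight) \<and>
           i' < i \<and> P (i',k') = Cross \<and> traverses P c1 (i',k') \<and> traverses P c2 (i',k')))"

definition MRPD :: "nat list \<Rightarrow> pd set" where
  "MRPD v = {P. reduced v P \<and> markings_ok v P}"

definition col :: "nat list \<Rightarrow> nat \<Rightarrow> nat" where
  "col v j = (THE k. 1 \<le> k \<and> k \<le> length v \<and> sort v ! (k-1) = j)"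

definition removable :: "nat list \<Rightarrow> pd \<Rightarrow> nat \<Rightarrow> bool" where
  "removable v P j \<longleftrightarrow> j \<in> set v \<and>
     (let C = col v j; m = length v in
       (\<exists>r. (\<forall>i. 1 \<le> i \<and> i \<le> r \<longrightarrow> P (i, C) = Cross \<and> traverses P C (i, C)) \<and>
            (\<forall>i. r < i \<and> i + C \<le> m + 1 \<longrightarrow> P (i, C) = Bump False)) \<and>
       (\<forall>i k. traverses P C (i,k) \<and> P (i,k) = Cross \<and> 2 \<le> i \<longrightarrow> P (i-1, k) \<noteq> Bump False) \<and>
       (\<forall>p. traverses P C p \<longrightarrow> P p \<noteq> Bump True))"

definition CMRPD :: "nat list \<Rightarrow> pd set" where
  "CMRPD v = {P \<in> MRPD v. \<forall>j. \<not> removable v P j}"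

text \<open>The single-pipe reduction Phi_j (meaningful for removable j).  In column c < C_j,
  r is the row where pipe j enters column c from the right.\<close>
definition phi1 :: "nat list \<Rightarrow> nat \<Rightarrow> pd \<Rightarrow> pd" where
  "phi1 v j P = (let C = col v j in
     (\<lambda>(i,c). if i = 0 \<or> c = 0 then Bump False
              else if C \<le> c then P (i, c+1)
              else (let r = (THE r. visits P C (r, c, FromRight)) in
                     if i < r then P (i, c)
                     else if i = r \<and> P (r, c) \<noteq> Cross then Bump False
                     else P (i+1, c))))"

definition Phi :: "nat list \<Rightarrow> pd \<Rightarrow> nat list \<times> pd" where
  "Phi w P = foldl (\<lambda>(v, Q) j. (remove1 j v, phi1 v j Q)) (w, P)
                 (sorted_list_of_set {j. removable w P j})"

definition avoids_1423 :: "nat list \<Rightarrow> bool" where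
  "avoids_1423 w \<longleftrightarrow> \<not> (\<exists>a b c d. a < b \<and> b < c \<and> c < d \<and> d < length w \<and>
       w ! a < w ! c \<and> w ! c < w ! d \<and> w ! d < w ! b)"

end

theory Submission
  imports Defs
begin

text \<open>Label every edge of the grid by the pipe passing through it.  A pipe dream is reduced iff
  at each crossing the label entering from the top is smaller than the one entering from the right,
  and a bump may be marked iff it is larger; so membership in MRPD becomes a local condition.

  A removable pipe moves weakly down from its column to its exit row, and read from the exit row to
  the right it is forced: in each column it splits the tile above it if that is an unmarked bump,
  and otherwise crosses.  Hence the reduction of one pipe is injective, and every pipe dream Q for
  v without j comes from exactly one pipe dream P, obtained by inserting j along this greedy path;
  the labels of P are those of Q, renamed.  The only condition that P can violate is that the pipes crossed by
  j on its way left have smaller labels.  In the leftmost column where this fails, two pipes a < b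
  larger than j, meet just above the path and part in inverted order; afterwards b stays above the path, a stays
  below it, and some pipe smaller than j leaves above b.  These four pipes form the pattern 1423.\<close>

section \<open>Edge labels\<close>

text \<open>Why one tile suffices to test reducedness: scan the tiles row by row from the top, each
  row from right to left. The labels on the boundary of the scanned region form a permutation that
  starts as the identity; a crossing exchanges two neighbouring labels, a bump changes nothing.
  Hence two labels can be inverted only if their pipes have already crossed, and if every crossing
  creates an inversion, no pair crosses twice. The comparison of the two labels at a tile thus
  records whether the pipes have met in a crossing before. Pipes can be treated one at a time
  because inserting \<open>j\<close> keeps the order of the other labels and the removability of the
  other pipes. The intermediate words are no longer permutations of 1..n, so the work is done for
  words with distinct entries; pipes are named by their entry column, and \<open>sort v\<close>
  translates back to entries.\<close>

text \<open>T i k and R i k are the pipes entering tile (i,k) from the top and from the right; R i 0 is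
  the pipe leaving row i.\<close>

definition labelling :: "pd \<Rightarrow> (nat \<Rightarrow> nat \<Rightarrow> nat) \<Rightarrow> (nat \<Rightarrow> nat \<Rightarrow> nat) \<Rightarrow> bool" where
  "labelling P T R \<longleftrightarrow> (\<forall>k\<ge>1. T 1 k = k) \<and>
     (\<forall>i k. 1 \<le> i \<and> 1 \<le> k \<longrightarrow>
        (if P (i,k) = Cross then T (i+1) k = T i k \<and> R i (k-1) = R i k
         else T (i+1) k = R i k \<and> R i (k-1) = T i k))"

lemma labelling_top: "labelling P T R \<Longrightarrow> 1 \<le> k \<Longrightarrow> T 1 k = k"
  by (auto simp: labelling_def)

lemma labelling_Cross:
  assumes "labelling P T R" "1 \<le> i" "1 \<le> k" "P (i,k) = Cross"
  shows "T (i+1) k = T i k" "T (Suc i) k = T i k" "R i (k-1) = R i k"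
proof -
  have "1 \<le> i \<and> 1 \<le> k \<longrightarrow> (if P (i,k) = Cross then T (i+1) k = T i k \<and> R i (k-1) = R i k
         else T (i+1) k = R i k \<and> R i (k-1) = T i k)"
    using assms(1) unfolding labelling_def by blast
  with assms show "T (i+1) k = T i k" "T (Suc i) k = T i k" "R i (k-1) = R i k" by auto
qed

lemma labelling_Bump:
  assumes "labelling P T R" "1 \<le> i" "1 \<le> k" "P (i,k) \<noteq> Cross"
  shows "T (i+1) k = R i k" "T (Suc i) k = R i k" "R i (k-1) = T i k"
proof -
  have "1 \<le> i \<and> 1 \<le> k \<longrightarrow> (if P (i,k) = Cross then T (i+1) k = T i k \<and> R i (k-1) = R i k
         else T (i+1) k = R i k \<and> R i (k-1) = T i k)"
    using assms(1) unfolding labelling_def by blast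
  with assms show "T (i+1) k = R i k" "T (Suc i) k = R i k" "R i (k-1) = T i k" by auto
qed

lemma pd_outside:
  assumes "is_pipe_dream N P" "N + 1 < i + k"
  shows "P (i,k) = Bump False"
  using assms by (auto simp: is_pipe_dream_def staircase_def)

lemma pd_zero:
  assumes "is_pipe_dream N P"
  shows "P (0,k) = Bump False" "P (i,0) = Bump False"
  using assms by (auto simp: is_pipe_dream_def staircase_def)

lemma pd_not_Cross:
  assumes "is_pipe_dream N P" "N < i + k"
  shows "P (i,k) \<noteq> Cross"
proof (cases "i + k = N + 1 \<and> 1 \<le> i \<and> 1 \<le> k")
  case True
  then have "P (i, N + 1 - i) \<noteq> Cross" using assms unfolding is_pipe_dream_def by auto
  moreover have "N + 1 - i = k" using True by auto
  ultimately show ?thesis by simp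
next
  case False
  then have "(i,k) \<notin> staircase N" using assms by (auto simp: staircase_def)
  then show ?thesis using assms unfolding is_pipe_dream_def by auto
qed

text \<open>A label enters from the right after running through the crossings beyond column
  \<open>k\<close>; it comes from the top edge of the first tile that is not a crossing. The bound
  \<open>k < N\<close> ends the recursion, and a pipe dream of size \<open>N\<close> has no crossing
  in a column beyond \<open>N\<close>.\<close>

function row_right :: "nat \<Rightarrow> (nat \<Rightarrow> bool) \<Rightarrow> (nat \<Rightarrow> nat) \<Rightarrow> nat \<Rightarrow> nat" where
  "row_right N X t k = (if k < N \<and> X (Suc k) then row_right N X t (Suc k) else t (Suc k))"
  by auto
termination by (relation "measure (\<lambda>(N,X,t,k). N - k)") auto

declare row_right.simps[simp del]

text \<open>The index is off by one: \<open>row_top N P n\<close> gives the labels on the top edges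
  of row n + 1.\<close>

primrec row_top :: "nat \<Rightarrow> pd \<Rightarrow> nat \<Rightarrow> nat \<Rightarrow> nat" where
  "row_top N P 0 = (\<lambda>k. k)"
| "row_top N P (Suc n) = (\<lambda>k. if P (Suc n, k) = Cross then row_top N P n k
      else row_right N (\<lambda>k. P (Suc n, k) = Cross) (row_top N P n) k)"

lemma ex_labelling:
  assumes pd: "is_pipe_dream N P"
  obtains T R where "labelling P T R"
proof
  define T where "T = (\<lambda>i. row_top N P (i - 1))"
  define R where "R = (\<lambda>i. row_right N (\<lambda>k. P (i, k) = Cross) (T i))"
  show "labelling P T R"
    unfolding labelling_def
  proof (intro conjI allI impI)
    fix k :: nat assume "1 \<le> k" then show "T 1 k = k" by (simp add: T_def)
  next
    fix i k :: nat assume ik: "1 \<le> i \<and> 1 \<le> k"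
    then obtain n l where i: "i = Suc n" and k: "k = Suc l" by (metis Suc_le_D One_nat_def)
    have "P (i,k) = Cross \<Longrightarrow> l < N" using pd_not_Cross[OF pd, of i k] i k by fastforce
    then show "if P (i,k) = Cross then T (i+1) k = T i k \<and> R i (k-1) = R i k
         else T (i+1) k = R i k \<and> R i (k-1) = T i k"
      unfolding R_def T_def i k
      by (auto simp: row_right.simps[of N _ _ l])
  qed
qed

text \<open>Induction along the pipe. The column bounds hold since a pipe moves only down and left;
  the strict one for \<open>FromRight\<close> is the source of \<open>k < R i k\<close>.\<close>

lemma visits_label:
  assumes lab: "labelling P T R" and c: "1 \<le> c" and v: "visits P c s"
  shows "1 \<le> fst s \<and> 1 \<le> fst (snd s) \<and> fst (snd s) \<le> c \<and> (snd (snd s) = FromRight \<longrightarrow> fst (snd s) < c)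
    \<and> (case snd (snd s) of FromTop \<Rightarrow> T (fst s) (fst (snd s)) = c | FromRight \<Rightarrow> R (fst s) (fst (snd s)) = c)"
  using v
proof (induction rule: visits.induct)
  case vstart
  then show ?case using labelling_top[OF lab] c by auto
next
  case (vstep s s')
  obtain i k d where s: "s = (i,k,d)" by (cases s)
  have ik: "1 \<le> i" "1 \<le> k" using vstep s by auto
  show ?case
  proof (cases "P (i,k)")
    case Cross
    then show ?thesis using vstep ik labelling_Cross[OF lab ik Cross] unfolding s
      by (cases d) (auto split: if_splits)
  next
    case (Bump x)
    then have "P (i,k) \<noteq> Cross" by simp
    from labelling_Bump[OF lab ik this] show ?thesis using vstep ik Bump unfolding s
      by (cases d) (auto split: if_splits)
  qed
qed

text \<open>\<open>visits\<close> only follows pipes forward, so reaching every edge needs its own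
  argument. In a row, the right edges are handled from column \<open>N\<close> leftwards, starting
  at the bump in column N + 1; the top edges of the next row are the bottom edges of this
  one.\<close>

lemma visits_all:
  assumes pd: "is_pipe_dream N P" and i: "1 \<le> i"
  shows "\<forall>k\<ge>1. (\<exists>c\<ge>1. visits P c (i,k,FromTop)) \<and> (\<exists>c\<ge>1. visits P c (i,k,FromRight))"
proof -
  have right: "\<exists>c\<ge>1. visits P c (i,k,FromRight)" if top: "\<forall>k\<ge>1. \<exists>c\<ge>1. visits P c (i,k,FromTop)"
    and k: "1 \<le> k" for i k
  proof (cases "k \<le> N")
    case False
    then have B: "P (i, Suc k) = Bump False" using pd_outside[OF pd, of i "Suc k"] pd_zero[OF pd] by (cases i) auto
    obtain c where "c \<ge> 1" "visits P c (i,Suc k,FromTop)" using top[rule_format, of "Suc k"] by auto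
    with B k show ?thesis using vstep[of P c "(i,Suc k,FromTop)" "(i,k,FromRight)"] by auto
  next
    case True
    then show ?thesis using k
    proof (induction k rule: inc_induct)
      case base
      have B: "P (i, Suc N) = Bump False" using pd_outside[OF pd, of i "Suc N"] pd_zero[OF pd] by (cases i) auto
      obtain c where "c \<ge> 1" "visits P c (i,Suc N,FromTop)" using top[rule_format, of "Suc N"] by auto
      with B base show ?case using vstep[of P c "(i,Suc N,FromTop)" "(i,N,FromRight)"] by auto
    next
      case (step k)
      show ?case
      proof (cases "P (i, Suc k)")
        case Cross
        obtain c where "c \<ge> 1" "visits P c (i,Suc k,FromRight)" using step by auto
        with Cross step show ?thesis using vstep[of P c "(i,Suc k,FromRight)" "(i,k,FromRight)"] by auto
      next
        case (Bump x)
        obtain c where "c \<ge> 1" "visits P c (i,Suc k,FromTop)" using top[rule_format, of "Suc k"] by auto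
        with Bump step show ?thesis using vstep[of P c "(i,Suc k,FromTop)" "(i,k,FromRight)"] by auto
      qed
    qed
  qed
  have "\<forall>k\<ge>1. \<exists>c\<ge>1. visits P c (i,k,FromTop)" using i
  proof (induction i rule: dec_induct)
    case base
    then show ?case using vstart by blast
  next
    case (step i)
    show ?case
    proof (intro allI impI)
      fix k :: nat assume k: "1 \<le> k"
      show "\<exists>c\<ge>1. visits P c (Suc i,k,FromTop)"
      proof (cases "P (i, k)")
        case Cross
        obtain c where "c \<ge> 1" "visits P c (i,k,FromTop)" using step k by auto
        with Cross step show ?thesis using vstep[of P c "(i,k,FromTop)" "(Suc i,k,FromTop)"] by auto
      next
        case (Bump x)
        obtain c where "c \<ge> 1" "visits P c (i,k,FromRight)" using right[OF step.IH k] by auto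
        with Bump step show ?thesis using vstep[of P c "(i,k,FromRight)" "(Suc i,k,FromTop)"] by auto
      qed
    qed
  qed
  with right show ?thesis by blast
qed

locale labelled_pd =
  fixes N P T R
  assumes pd: "is_pipe_dream N P" and lab: "labelling P T R"
begin

lemmas Cross_simps = labelling_Cross[OF lab]
lemmas Bump_simps = labelling_Bump[OF lab]

lemma visits_topD: "1 \<le> c \<Longrightarrow> visits P c (i,k,FromTop) \<Longrightarrow> 1 \<le> i \<and> 1 \<le> k \<and> k \<le> c \<and> T i k = c"
  by (drule visits_label[OF lab]) auto

lemma visits_rightD: "1 \<le> c \<Longrightarrow> visits P c (i,k,FromRight) \<Longrightarrow> 1 \<le> i \<and> 1 \<le> k \<and> k < c \<and> R i k = c"
  by (drule visits_label[OF lab]) auto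

lemma visits_pos: "1 \<le> c \<Longrightarrow> visits P c (i,k,d) \<Longrightarrow> 1 \<le> i \<and> 1 \<le> k"
  using visits_topD visits_rightD by (cases d) blast+

lemma visits_T: "1 \<le> i \<Longrightarrow> 1 \<le> k \<Longrightarrow> visits P (T i k) (i,k,FromTop)"
  and T_ge: "1 \<le> i \<Longrightarrow> 1 \<le> k \<Longrightarrow> k \<le> T i k"
  using visits_all[OF pd, of i] visits_topD by blast+

lemma visits_R: "1 \<le> i \<Longrightarrow> 1 \<le> k \<Longrightarrow> visits P (R i k) (i,k,FromRight)"
  using visits_all[OF pd, of i] visits_rightD by blast

text \<open>Column 0 is separate because \<open>visits\<close> never gets there: the exit label
  \<open>R i 0\<close> is read off the tile (i,1).\<close>

lemma R_gt: "k < R i k" if i: "1 \<le> i"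
proof (cases "k = 0")
  case False
  then have "1 \<le> k" by simp
  then show ?thesis using visits_all[OF pd i] visits_rightD by blast
next
  case True
  have "1 \<le> T i 1" using T_ge i by auto
  moreover have "1 < R i 1" using visits_all[OF pd i] visits_rightD by blast
  ultimately show ?thesis
    using Cross_simps(3)[OF i, of 1] Bump_simps(3)[OF i, of 1] True by (cases "P (i,1) = Cross") auto
qed

lemma visits_top:
  assumes "1 \<le> c" "1 \<le> i" "1 \<le> k"
  shows "visits P c (i,k,FromTop) \<longleftrightarrow> T i k = c"
  using visits_T visits_topD assms by blast

lemma visits_right:
  assumes "1 \<le> c" "1 \<le> i" "1 \<le> k"
  shows "visits P c (i,k,FromRight) \<longleftrightarrow> R i k = c"
  using visits_R visits_rightD assms by blast

lemma traverses_iff: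
  assumes "1 \<le> c"
  shows "traverses P c (i,k) \<longleftrightarrow> 1 \<le> i \<and> 1 \<le> k \<and> (T i k = c \<or> R i k = c)"
proof
  assume "traverses P c (i,k)"
  then obtain d where d: "visits P c (i,k,d)" by (auto simp: traverses_def)
  with visits_pos[OF assms d] assms show "1 \<le> i \<and> 1 \<le> k \<and> (T i k = c \<or> R i k = c)"
    by (cases d) (auto simp: visits_top visits_right)
next
  assume "1 \<le> i \<and> 1 \<le> k \<and> (T i k = c \<or> R i k = c)"
  then show "traverses P c (i,k)" using assms visits_top visits_right unfolding traverses_def by fastforce
qed

lemma exits_row_iff:
  assumes "1 \<le> c" "1 \<le> i"
  shows "exits_row P c i \<longleftrightarrow> R i 0 = c"
proof (cases "P (i,1)")
  case Cross
  have "R i 0 = R i 1" using Cross_simps(3)[of i 1] assms Cross by auto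
  then have 1: "R i 0 = c \<longleftrightarrow> visits P c (i,1,FromRight)" using visits_right assms by auto
  have "step P (i,1,d) = None \<longleftrightarrow> d = FromRight" for d using Cross by (cases d) auto
  then show ?thesis unfolding exits_row_def 1 by auto
next
  case (Bump x)
  have "R i 0 = T i 1" using Bump_simps(3)[of i 1] assms Bump by auto
  then have 1: "R i 0 = c \<longleftrightarrow> visits P c (i,1,FromTop)" using visits_top assms by auto
  have "step P (i,1,d) = None \<longleftrightarrow> d = FromTop" for d using Bump by (cases d) auto
  then show ?thesis unfolding exits_row_def 1 by auto
qed

text \<open>Beyond the staircase every tile is a bump, so a pipe that enters there zigzags along
  its antidiagonal.\<close>

lemma far_pipe:
  assumes "N < c" and "visits P c s"
  shows "fst s + fst (snd s) = (case snd (snd s) of FromTop \<Rightarrow> c + 1 | FromRight \<Rightarrow> c)"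
  using assms(2)
proof (induction rule: visits.induct)
  case vstart
  then show ?case by auto
next
  case (vstep s s')
  obtain i k d where s: "s = (i,k,d)" by (cases s)
  have "P (i,k) \<noteq> Cross" using pd_not_Cross[OF pd, of i k] assms(1) vstep s by (cases d) auto
  then obtain x where "P (i,k) = Bump x" by (cases "P (i,k)") auto
  with vstep s show ?case by (cases d) (auto split: if_splits)
qed

lemma T_outside: "1 \<le> i \<Longrightarrow> 1 \<le> k \<Longrightarrow> N + 1 < i + k \<Longrightarrow> T i k = i + k - 1"
  and R_outside: "1 \<le> i \<Longrightarrow> N < i + k \<Longrightarrow> R i k = i + k"
proof -
  have rt: "R i k = T i (Suc k)" if "1 \<le> i" "N < i + k" for i k
    using Bump_simps(3)[of i "Suc k"] that pd_not_Cross[OF pd, of i "Suc k"] by auto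
  have T: "T i k = i + k - 1" if "1 \<le> i" "1 \<le> k" "N + 1 < i + k" for i k
    using that
  proof (induction i arbitrary: k rule: dec_induct)
    case base
    then show ?case using labelling_top[OF lab] by auto
  next
    case (step i)
    then have "T (Suc i) k = T i (Suc k)"
      using Bump_simps(2)[of i k] pd_not_Cross[OF pd, of i k] rt[of i k] by auto
    then show ?case using step by auto
  qed
  then show "1 \<le> i \<Longrightarrow> 1 \<le> k \<Longrightarrow> N + 1 < i + k \<Longrightarrow> T i k = i + k - 1" .
  show "1 \<le> i \<Longrightarrow> N < i + k \<Longrightarrow> R i k = i + k" using rt T by auto
qed

lemma T_inside: "1 \<le> i \<Longrightarrow> 1 \<le> k \<Longrightarrow> i + k \<le> N + 1 \<Longrightarrow> T i k \<le> N"
  using far_pipe[of "T i k" "(i,k,FromTop)"] visits_top[of "T i k" i k] T_ge[of i k] by (cases "N < T i k") auto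

lemma R_inside: "1 \<le> i \<Longrightarrow> i + k \<le> N \<Longrightarrow> R i k \<le> N"
proof (cases "k = 0")
  case True
  assume i: "1 \<le> i" "i + k \<le> N"
  have R1: "R i 1 \<le> N" if "P (i,1) = Cross"
  proof -
    have "i + 1 \<le> N" using that pd_not_Cross[OF pd, of i 1] by fastforce
    then show ?thesis using far_pipe[of "R i 1" "(i,1,FromRight)"] visits_right[of "R i 1" i 1] R_gt[of i 1] i by (cases "N < R i 1") auto
  qed
  have "T i 1 \<le> N" using T_inside i by auto
  with R1 show ?thesis
    using Cross_simps(3)[of i 1] Bump_simps(3)[of i 1] True i by (cases "P (i,1) = Cross") auto
next
  case False
  assume i: "1 \<le> i" "i + k \<le> N"
  then show ?thesis using False far_pipe[of "R i k" "(i,k,FromRight)"] visits_right[of "R i k" i k] R_gt[of i k] by (cases "N < R i k") auto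
qed

section \<open>Frontiers and inversions\<close>

text \<open>The labels met from upper left to lower right by the boundary of the part of the grid that
  consists of the rows above i and of the tiles of row i to the right of column k.\<close>

definition frontier :: "nat \<Rightarrow> nat \<Rightarrow> nat \<Rightarrow> nat" where
  "frontier i k s = (if s < i then R s 0 else if s < i + k then T i (s + 1 - i)
     else if s = i + k then R i k else T (i+1) (s - i))"

lemma frontier_first: "N \<le> k \<Longrightarrow> 1 \<le> s \<Longrightarrow> frontier 1 k s = s"
  unfolding frontier_def using labelling_top[OF lab] T_outside[of 2 "s-1"] R_outside[of 1 k]
  by (auto simp: numeral_2_eq_2)

text \<open>The scan passes from the left end of row i to the right end of row i + 1; outside the
  staircase both boundaries read the same antidiagonal labels.\<close>

lemma frontier_row: "1 \<le> i \<Longrightarrow> N \<le> k \<Longrightarrow> frontier (Suc i) k s = frontier i 0 s"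
  unfolding frontier_def using T_outside[of "Suc (Suc i)" "s - Suc i"]  T_outside[of "Suc i" "s - i"]
    R_outside[of "Suc i" k] by (cases "s < Suc i + k"; cases "s = Suc i + k") auto

text \<open>The simple transposition of the positions a and a + 1.\<close>

definition swap :: "nat \<Rightarrow> nat \<Rightarrow> nat" where
  "swap a s = (if s = a then Suc a else if s = Suc a then a else s)"

text \<open>Scanning tile (i, k+1) replaces its top and right edges by its left and bottom edges, at
  positions i + k and i + k + 1. So the frontiers are the partial products of the reading word of
  \<open>P\<close>.\<close>

lemma frontier_step:
  assumes "1 \<le> i"
  shows "frontier i k s = (if P (i, Suc k) = Cross then frontier i (Suc k) (swap (i + k) s) else frontier i (Suc k) s)"
  using Cross_simps[of i "Suc k"] Bump_simps[of i "Suc k"] assms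
  by (cases "s = i + k"; cases "s = Suc (i + k)") (auto simp: frontier_def swap_def Suc_diff_le)

text \<open>Induction in reading order. The base case is row 1 right of all crossings, where the
  frontier is the identity.\<close>

lemma frontier_induct [consumes 1, case_names first tile row]:
  assumes "1 \<le> i"
    and first: "\<And>k. N \<le> k \<Longrightarrow> \<Pi> 1 k"
    and tile: "\<And>i k. 1 \<le> i \<Longrightarrow> \<Pi> i (Suc k) \<Longrightarrow> \<Pi> i k"
    and row: "\<And>i k. 1 \<le> i \<Longrightarrow> N \<le> k \<Longrightarrow> \<Pi> i 0 \<Longrightarrow> \<Pi> (Suc i) k"
  shows "\<Pi> i k"
proof -
  have all: "\<Pi> i k" if "\<And>k. N \<le> k \<Longrightarrow> \<Pi> i k" "1 \<le> i" for i k
  proof (cases "N \<le> k")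
    case False
    then have "k \<le> N" by simp
    then show ?thesis by (induction k rule: inc_induct) (use that tile in auto)
  qed (use that in auto)
  show ?thesis using assms(1)
    by (induction i arbitrary: k rule: dec_induct) (use all first row in auto)
qed

lemma swap_inj: "swap a s = swap a t \<longleftrightarrow> s = t"
  by (auto simp: swap_def)

lemma swap_ge1: "1 \<le> a \<Longrightarrow> 1 \<le> s \<Longrightarrow> 1 \<le> swap a s"
  by (auto simp: swap_def)

lemma swap_swap: "swap a (swap a s) = s"
  by (auto simp: swap_def)

lemma swap_less: "s < t \<Longrightarrow> \<not> (s = a \<and> t = Suc a) \<Longrightarrow> swap a s < swap a t"
  by (auto simp: swap_def)

lemma frontier_inj:
  assumes "1 \<le> i" "1 \<le> s" "1 \<le> t" "frontier i k s = frontier i k t"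
  shows "s = t"
  using assms
proof (induction i k arbitrary: s t rule: frontier_induct)
  case (first k)
  then show ?case by (simp add: frontier_first del: One_nat_def)
next
  case (tile i k)
  have 1: "1 \<le> i + k" using tile by simp
  show ?case
  proof (cases "P (i, Suc k) = Cross")
    case True
    then show ?thesis using tile.IH[of "swap (i+k) s" "swap (i+k) t"] tile swap_inj swap_ge1[OF 1]
      by (metis frontier_step)
  next
    case False
    then show ?thesis using tile by (metis frontier_step)
  qed
next
  case (row i k)
  then show ?case by (metis frontier_row)
qed

text \<open>The crossings inside the region whose boundary is \<open>frontier i k\<close>.\<close>

definition earlier :: "nat \<Rightarrow> nat \<Rightarrow> nat \<Rightarrow> nat \<Rightarrow> bool" where
  "earlier i k i' k' \<longleftrightarrow> 1 \<le> i' \<and> 1 \<le> k' \<and> (i' < i \<or> i' = i \<and> k < k') \<and> P (i',k') = Cross"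

lemma earlier_first: "N \<le> k \<Longrightarrow> \<not> earlier 1 k i' k'"
  using pd_not_Cross[OF pd, of i' k'] by (auto simp: earlier_def)

lemma earlier_row: "N \<le> k \<Longrightarrow> earlier (Suc i) k i' k' \<Longrightarrow> earlier i 0 i' k'"
  using pd_not_Cross[OF pd, of i' k'] by (auto simp: earlier_def less_Suc_eq)

lemma earlier_step: "earlier i k i' k' \<longleftrightarrow> earlier i (Suc k) i' k' \<or> (1 \<le> i \<and> i' = i \<and> k' = Suc k \<and> P (i',k') = Cross)"
  by (auto simp: earlier_def)

lemma earlier_skip:
  assumes "P (i, Suc k) \<noteq> Cross"
  shows "earlier i k = earlier i (Suc k)"
proof (intro ext)
  fix i' k'
  show "earlier i k i' k' = earlier i (Suc k) i' k'"
    using earlier_step[of i k i' k'] assms by auto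
qed

lemma earlier_mono: "earlier i 0 i' k' \<Longrightarrow> earlier (Suc i) k i' k'"
  by (auto simp: earlier_def)

text \<open>The relative order of two labels changes only when they are exchanged as neighbours.
  Either the tile just scanned did this and is the witness, or the inversion was already there at
  the positions before the exchange.\<close>

lemma frontier_inversion:
  assumes "1 \<le> i" "1 \<le> s" "s < t" "frontier i k t < frontier i k s"
  shows "\<exists>i' k'. earlier i k i' k' \<and>
     {T i' k', R i' k'} = {frontier i k s, frontier i k t}"
  using assms
proof (induction i k arbitrary: s t rule: frontier_induct)
  case (first k)
  then show ?case by (simp add: frontier_first del: One_nat_def)
next
  case (tile i k)
  have 1: "1 \<le> i + k" using tile by simp
  have ik: "1 \<le> i" using tile by simp
  show ?case
  proof (cases "P (i, Suc k) = Cross")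
    case True
    note fs = frontier_step[OF \<open>1 \<le> i\<close>, of k]
    show ?thesis
    proof (cases "s = i + k \<and> t = Suc (i + k)")
      case st: True
      then have "frontier i k s = R i (Suc k)" "frontier i k t = T i (Suc k)"
        using True Cross_simps(2)[OF ik, of "Suc k"] Cross_simps(3)[OF ik, of "Suc k"] by (auto simp: frontier_def)
      moreover have "earlier i k i (Suc k)" using True ik by (auto simp: earlier_def)
      ultimately show ?thesis by (metis insert_commute)
    next
      case False
      have "\<exists>i' k'. earlier i (Suc k) i' k' \<and>
          {T i' k', R i' k'} = {frontier i (Suc k) (swap (i+k) s), frontier i (Suc k) (swap (i+k) t)}"
        by (rule tile.IH) (use False tile swap_less swap_ge1[OF 1] fs True in auto)
      then obtain i' k' where e: "earlier i (Suc k) i' k'"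
        and "{T i' k', R i' k'} = {frontier i (Suc k) (swap (i+k) s), frontier i (Suc k) (swap (i+k) t)}"
        by blast
      then have "{T i' k', R i' k'} = {frontier i k s, frontier i k t}" using fs True by simp
      moreover have "earlier i k i' k'" using e earlier_step[of i k i' k'] by blast
      ultimately show ?thesis by blast
    qed
  next
    case False
    have "frontier i k = frontier i (Suc k)" "earlier i k = earlier i (Suc k)"
      using frontier_step[OF ik, of k] earlier_skip False by auto
    then show ?thesis using tile.IH[of s t] tile.prems by simp
  qed
next
  case (row i k)
  have "frontier (Suc i) k = frontier i 0" using frontier_row row by blast
  then obtain i' k' where "earlier i 0 i' k'" "{T i' k', R i' k'} = {frontier i 0 s, frontier i 0 t}"
    using row.IH[of s t] row.prems by auto
  then show ?case using \<open>frontier (Suc i) k = frontier i 0\<close> earlier_mono by (intro exI[of _ i'] exI[of _ k']) simp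
qed

text \<open>The converse requires that each crossing creates an inversion: then the larger label,
  once it has moved in front of the smaller, stays there.\<close>

lemma frontier_crossed:
  assumes red: "\<And>i k. 1 \<le> i \<Longrightarrow> 1 \<le> k \<Longrightarrow> P (i,k) = Cross \<Longrightarrow> T i k < R i k"
  assumes "1 \<le> i" "earlier i k i' k'"
  shows "\<exists>s t. 1 \<le> s \<and> s < t \<and> frontier i k s = R i' k' \<and> frontier i k t = T i' k'"
  using assms(2,3)
proof (induction i k rule: frontier_induct)
  case (first k)
  then show ?case using earlier_first by blast
next
  case (tile i k)
  have 1: "1 \<le> i + k" using tile by simp
  have ik: "1 \<le> i" using tile by simp
  show ?case
  proof (cases "P (i, Suc k) = Cross")
    case True
    note fs = frontier_step[OF \<open>1 \<le> i\<close>, of k]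
    have new: "frontier i k (i + k) = R i (Suc k)" "frontier i k (Suc (i + k)) = T i (Suc k)"
        using True Cross_simps(2)[OF ik, of "Suc k"] Cross_simps(3)[OF ik, of "Suc k"] by (auto simp: frontier_def)
    show ?thesis
    proof (cases "earlier i (Suc k) i' k'")
      case False
      then have "i' = i" "k' = Suc k" using tile(3) earlier_step[of i k i' k'] by auto
      then show ?thesis using new 1 by auto
    next
      case e: True
      then obtain s t where st: "1 \<le> s" "s < t" "frontier i (Suc k) s = R i' k'" "frontier i (Suc k) t = T i' k'"
        using tile.IH by blast
      \<comment> \<open>Exchanging the same two labels back would be a crossing with the larger
        label on top, against \<open>red\<close>.\<close>
      have "\<not> (s = i + k \<and> t = Suc (i + k))"
      proof
        assume "s = i + k \<and> t = Suc (i + k)"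
        then have "R i' k' = T i (Suc k)" "T i' k' = R i (Suc k)" using st by (auto simp: frontier_def)
        moreover have "T i' k' < R i' k'" using e red by (auto simp: earlier_def)
        ultimately show False using red[OF ik _ True] by auto
      qed
      then have "swap (i+k) s < swap (i+k) t" using st swap_less by blast
      moreover have "frontier i k (swap (i+k) s) = R i' k'" "frontier i k (swap (i+k) t) = T i' k'"
        using fs True st swap_swap by auto
      ultimately show ?thesis using st swap_ge1[OF 1] by blast
    qed
  next
    case False
    have "frontier i k = frontier i (Suc k)" "earlier i k = earlier i (Suc k)"
      using frontier_step[OF ik, of k] earlier_skip False by auto
    then show ?thesis using tile.IH tile.prems by simp
  qed
next
  case (row i k)
  have "frontier (Suc i) k = frontier i 0" using frontier_row row by blast
  then show ?case using row.IH row.prems row.hyps earlier_row by simp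
qed

lemma frontier_at:
  assumes "1 \<le> k"
  shows "frontier i k (i + k - 1) = T i k" "frontier i k (i + k) = R i k"
  using assms by (auto simp: frontier_def)

end

section \<open>Reducedness, markings and exit rows read off the labels\<close>

context labelled_pd
begin

lemma frontier_eq_T_iff:
  assumes "1 \<le> i" "1 \<le> k" "1 \<le> s"
  shows "frontier i k s = T i k \<longleftrightarrow> s = i + k - 1"
proof -
  have "1 \<le> i + k - 1" using assms by auto
  then show ?thesis using frontier_inj[of i s "i + k - 1" k] frontier_at(1)[of k i] assms by metis
qed

lemma frontier_eq_R_iff:
  assumes "1 \<le> i" "1 \<le> k" "1 \<le> s"
  shows "frontier i k s = R i k \<longleftrightarrow> s = i + k"
proof -
  have "1 \<le> i + k" using assms by auto
  then show ?thesis using frontier_inj[of i s "i + k" k] frontier_at(2)[of k i] assms by metis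
qed

lemma T_neq_R:
  assumes "1 \<le> i" "1 \<le> k"
  shows "T i k \<noteq> R i k"
proof -
  have "i + k \<noteq> i + k - 1" "1 \<le> i + k" using assms by auto
  then have "frontier i k (i + k) \<noteq> T i k" using frontier_eq_T_iff assms by blast
  then show ?thesis using frontier_at(2)[OF assms(2)] by metis
qed

text \<open>After their crossing the two pipes stand inverted on every later frontier, where the top
  label of a tile sits just before its right label; so they can meet again only with the roles of
  top and right exchanged.\<close>

lemma earlier_crossed:
  assumes red: "\<And>i k. 1 \<le> i \<Longrightarrow> 1 \<le> k \<Longrightarrow> P (i,k) = Cross \<Longrightarrow> T i k < R i k"
    and ik: "1 \<le> i" "1 \<le> k" and e: "earlier i k i' k'"
  shows "\<not> (T i k = T i' k' \<and> R i k = R i' k')"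
proof
  assume eq: "T i k = T i' k' \<and> R i k = R i' k'"
  obtain s t where st: "1 \<le> s" "s < t" "frontier i k s = R i' k'" "frontier i k t = T i' k'"
    using frontier_crossed[OF red ik(1) e] by blast
  then have "s = i + k" "t = i + k - 1"
    using frontier_eq_R_iff[OF ik, of s] frontier_eq_T_iff[OF ik, of t] eq by simp_all
  with st show False by auto
qed

lemma tile_inversion:
  assumes ik: "1 \<le> i" "1 \<le> k" and inv: "R i k < T i k"
  obtains i' k' where "earlier i k i' k'" "{T i' k', R i' k'} = {T i k, R i k}"
proof -
  have "1 \<le> i + k - 1" "i + k - 1 < i + k" using ik by auto
  then show ?thesis
    using frontier_inversion[OF ik(1), of "i + k - 1" "i + k" k] frontier_at[OF ik(2)] inv that by force
qed

text \<open>A crossing with the larger label on top is an inversion, so its pipes crossed before.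
  Conversely, two crossings of one pair would both have the smaller label on top, which
  \<open>earlier_crossed\<close> forbids for the later one.\<close>

lemma crossing_once_iff:
  "(\<forall>c1 c2 p q. 1 \<le> c1 \<and> c1 \<le> N \<and> 1 \<le> c2 \<and> c2 \<le> N \<and> c1 \<noteq> c2 \<and>
        P p = Cross \<and> traverses P c1 p \<and> traverses P c2 p \<and>
        P q = Cross \<and> traverses P c1 q \<and> traverses P c2 q \<longrightarrow> p = q)
   \<longleftrightarrow> (\<forall>i k. 1 \<le> i \<and> 1 \<le> k \<and> P (i,k) = Cross \<longrightarrow> T i k < R i k)" (is "?L \<longleftrightarrow> ?R")
proof
  assume L: ?L
  show ?R
  proof (intro allI impI, rule ccontr)
    fix i k assume ik: "1 \<le> i \<and> 1 \<le> k \<and> P (i,k) = Cross" and "\<not> T i k < R i k"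
    then have inv: "R i k < T i k" using T_neq_R[of i k] by auto
    have le: "i + k \<le> N" using pd_not_Cross[OF pd, of i k] ik by fastforce
    have b: "1 \<le> T i k" "T i k \<le> N" "1 \<le> R i k" "R i k \<le> N"
      using T_ge[of i k] R_gt[of i k] T_inside[of i k] R_inside[of i k] ik le by auto
    obtain i' k' where e: "earlier i k i' k'" and eq: "{T i' k', R i' k'} = {T i k, R i k}"
      using tile_inversion[of i k] ik inv by blast
    have e': "1 \<le> i'" "1 \<le> k'" "P (i',k') = Cross" "(i',k') \<noteq> (i,k)" using e by (auto simp: earlier_def)
    have "traverses P (T i k) (i,k)" "traverses P (R i k) (i,k)"
      using b ik by (auto simp: traverses_iff)
    moreover have "traverses P (T i k) (i',k')" "traverses P (R i k) (i',k')"
      using b e' eq by (auto simp: traverses_iff doubleton_eq_iff)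
    ultimately have "(i,k) = (i',k')"
      using L[rule_format, of "T i k" "R i k" "(i,k)" "(i',k')"] ik b inv e' by simp
    with e' show False by simp
  qed
next
  assume R: ?R
  then have red: "\<And>i k. 1 \<le> i \<Longrightarrow> 1 \<le> k \<Longrightarrow> P (i,k) = Cross \<Longrightarrow> T i k < R i k" by blast
  show ?L
  proof (intro allI impI)
    fix c1 c2 p q
    assume *: "1 \<le> c1 \<and> c1 \<le> N \<and> 1 \<le> c2 \<and> c2 \<le> N \<and> c1 \<noteq> c2 \<and>
        P p = Cross \<and> traverses P c1 p \<and> traverses P c2 p \<and>
        P q = Cross \<and> traverses P c1 q \<and> traverses P c2 q"
    obtain i k i' k' where pq: "p = (i,k)" "q = (i',k')" by (cases p, cases q)
    have ik: "1 \<le> i" "1 \<le> k" "P (i,k) = Cross" "1 \<le> i'" "1 \<le> k'" "P (i',k') = Cross"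
      and "T i k = c1 \<or> R i k = c1" "T i k = c2 \<or> R i k = c2"
         "T i' k' = c1 \<or> R i' k' = c1" "T i' k' = c2 \<or> R i' k' = c2"
      using * by (auto simp: traverses_iff pq)
    with red[OF ik(1-3)] red[OF ik(4-6)] * have eq: "T i k = T i' k' \<and> R i k = R i' k'" by auto
    have "\<not> earlier i k i' k'" using earlier_crossed[OF red ik(1,2)] eq by blast
    moreover have "\<not> earlier i' k' i k" using earlier_crossed[OF red ik(4,5)] eq by metis
    ultimately show "p = q" using ik unfolding pq earlier_def by auto
  qed
qed

text \<open>The earlier crossing demanded for a mark exists exactly when the two labels are inverted
  at the tile; what remains is to place that crossing in a strictly higher row.\<close>

lemma markings_iff:
  assumes red: "\<And>i k. 1 \<le> i \<Longrightarrow> 1 \<le> k \<Longrightarrow> P (i,k) = Cross \<Longrightarrow> T i k < R i k"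
    and N: "N = length v"
  shows "markings_ok v P \<longleftrightarrow> (\<forall>i k. 1 \<le> i \<and> 1 \<le> k \<and> P (i,k) = Bump True \<longrightarrow> R i k < T i k)" (is "_ \<longleftrightarrow> ?R")
proof
  assume L: "markings_ok v P"
  show ?R
  proof (intro allI impI, rule ccontr)
    fix i k assume ik: "1 \<le> i \<and> 1 \<le> k \<and> P (i,k) = Bump True" and "\<not> R i k < T i k"
    then have inv: "T i k < R i k" using T_neq_R[of i k] by auto
    obtain c1 c2 i' k' where c: "1 \<le> c1" "1 \<le> c2" "visits P c1 (i, k, FromTop)" "visits P c2 (i, k, FromRight)"
      "i' < i" "P (i',k') = Cross" "traverses P c1 (i',k')" "traverses P c2 (i',k')"
      using L ik unfolding markings_ok_def by blast
    have c12: "c1 = T i k" "c2 = R i k" using c ik visits_top visits_right by auto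
    have "1 \<le> i'" "1 \<le> k'" "T i' k' = c1 \<or> R i' k' = c1" "T i' k' = c2 \<or> R i' k' = c2"
      using c by (auto simp: traverses_iff)
    then have "T i k = T i' k' \<and> R i k = R i' k'" using red[of i' k'] c(6) c12 inv by auto
    moreover have "earlier i k i' k'" using c \<open>1 \<le> i'\<close> \<open>1 \<le> k'\<close> by (auto simp: earlier_def)
    ultimately show False using earlier_crossed[OF red, of i k i' k'] ik by blast
  qed
next
  assume R: ?R
  show "markings_ok v P"
    unfolding markings_ok_def
  proof (intro allI impI)
    fix i k assume m: "P (i,k) = Bump True"
    then have "(i,k) \<in> staircase N" using pd unfolding is_pipe_dream_def by fastforce
    then have ik: "1 \<le> i" "1 \<le> k" "i + k \<le> N + 1" by (auto simp: staircase_def)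
    have inv: "R i k < T i k" using R ik m by blast
    \<comment> \<open>On the outer diagonal the right label is N + 1 and exceeds the top label, so
      no mark is possible.\<close>
    have "i + k \<noteq> N + 1" using R_outside[of i k] T_inside[of i k] inv ik by auto
    then have le: "i + k \<le> N" using ik by auto
    have b: "1 \<le> T i k" "T i k \<le> N" "1 \<le> R i k" "R i k \<le> N"
      using T_ge[of i k] R_gt[of i k] T_inside[of i k] R_inside[of i k] ik le by auto
    obtain i' k' where e: "earlier i k i' k'" and eq: "{T i' k', R i' k'} = {T i k, R i k}"
      using tile_inversion[of i k] ik inv by blast
    have e': "1 \<le> i'" "1 \<le> k'" "P (i',k') = Cross" using e by (auto simp: earlier_def)
    \<comment> \<open>A crossing further right in row i would leave its top label at position i + k'
      of the frontier, while the two labels of tile (i,k) occupy only the positions i + k - 1 and i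
      + k.\<close>
    have "i' < i"
    proof (rule ccontr)
      assume "\<not> i' < i"
      then have "i' = i" "k < k'" using e by (auto simp: earlier_def)
      then have "frontier i k (i + k') = T i k'"
        using Cross_simps(1)[of i k'] e' by (auto simp: frontier_def)
      moreover have "T i k' = T i k \<or> T i k' = R i k" using eq \<open>i' = i\<close> by (auto simp: doubleton_eq_iff)
      ultimately show False
        using frontier_eq_T_iff[OF ik(1,2), of "i + k'"] frontier_eq_R_iff[OF ik(1,2), of "i + k'"]
          ik \<open>k < k'\<close> by auto
    qed
    moreover have "traverses P (T i k) (i',k')" "traverses P (R i k) (i',k')"
      using b e' eq by (auto simp: traverses_iff doubleton_eq_iff)
    moreover have "visits P (T i k) (i,k,FromTop)" "visits P (R i k) (i,k,FromRight)"
      using visits_T visits_R ik by auto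
    ultimately show "\<exists>c1 c2 i' k'. 1 \<le> c1 \<and> c1 \<le> length v \<and> 1 \<le> c2 \<and> c2 \<le> length v \<and>
           visits P c1 (i, k, FromTop) \<and> visits P c2 (i, k, FromRight) \<and>
           i' < i \<and> P (i',k') = Cross \<and> traverses P c1 (i',k') \<and> traverses P c2 (i',k')"
      using b e' N by blast
  qed
qed

text \<open>The definition quantifies over pipes, the right-hand side over rows. Distinctness makes
  \<open>sort v\<close> injective on indices, and \<open>R_inside\<close> keeps the exit labels of
  the first \<open>N\<close> rows among 1..N.\<close>

lemma exits_iff:
  assumes N: "N = length v" and v: "distinct v"
  shows "(\<forall>k i. 1 \<le> k \<and> k \<le> length v \<and> 1 \<le> i \<and> i \<le> length v \<and> v ! (i-1) = sort v ! (k-1)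
        \<longrightarrow> exits_row P k i) \<longleftrightarrow> (\<forall>i. 1 \<le> i \<and> i \<le> N \<longrightarrow> v ! (i-1) = sort v ! (R i 0 - 1))" (is "?L \<longleftrightarrow> ?R")
proof
  assume L: ?L
  show ?R
  proof (intro allI impI)
    fix i assume i: "1 \<le> i \<and> i \<le> N"
    then have "v ! (i-1) \<in> set (sort v)" using N by auto
    then obtain l where l: "l < length v" "sort v ! l = v ! (i-1)"
      unfolding in_set_conv_nth length_sort by blast
    then have "exits_row P (Suc l) i" using L[rule_format, of "Suc l" i] i N by auto
    then show "v ! (i-1) = sort v ! (R i 0 - 1)" using exits_row_iff[of "Suc l" i] i l by auto
  qed
next
  assume R: ?R
  show ?L
  proof (intro allI impI)
    fix k i assume *: "1 \<le> k \<and> k \<le> length v \<and> 1 \<le> i \<and> i \<le> length v \<and> v ! (i-1) = sort v ! (k-1)"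
    then have "1 \<le> R i 0" "R i 0 \<le> N" using R_gt[of i 0] R_inside[of i 0] N by auto
    moreover have "sort v ! (R i 0 - 1) = sort v ! (k-1)" using R * N by auto
    ultimately have "R i 0 - 1 = k - 1"
      using nth_eq_iff_index_eq[of "sort v" "R i 0 - 1" "k - 1"] * N v by auto
    then have "R i 0 = k" using * \<open>1 \<le> R i 0\<close> by auto
    then show "exits_row P k i" using * exits_row_iff by auto
  qed
qed

end

definition good_labels :: "pd \<Rightarrow> (nat \<Rightarrow> nat \<Rightarrow> nat) \<Rightarrow> (nat \<Rightarrow> nat \<Rightarrow> nat) \<Rightarrow> bool" where
  "good_labels P T R \<longleftrightarrow> (\<forall>i k. 1 \<le> i \<and> 1 \<le> k \<longrightarrow>
     (P (i,k) = Cross \<longrightarrow> T i k < R i k) \<and> (P (i,k) = Bump True \<longrightarrow> R i k < T i k))"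

definition exit_labels :: "nat list \<Rightarrow> (nat \<Rightarrow> nat \<Rightarrow> nat) \<Rightarrow> bool" where
  "exit_labels v R \<longleftrightarrow> (\<forall>i. 1 \<le> i \<and> i \<le> length v \<longrightarrow> v ! (i-1) = sort v ! (R i 0 - 1))"

lemma MRPD_iff:
  assumes lab: "labelling P T R" and v: "distinct v"
  shows "P \<in> MRPD v \<longleftrightarrow> is_pipe_dream (length v) P \<and> good_labels P T R \<and> exit_labels v R"
proof (cases "is_pipe_dream (length v) P")
  case True
  then interpret labelled_pd "length v" P T R using lab by (rule labelled_pd.intro)
  have good: "good_labels P T R \<longleftrightarrow> (\<forall>i k. 1 \<le> i \<and> 1 \<le> k \<and> P (i,k) = Cross \<longrightarrow> T i k < R i k) \<and>
      (\<forall>i k. 1 \<le> i \<and> 1 \<le> k \<and> P (i,k) = Bump True \<longrightarrow> R i k < T i k)"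
    unfolding good_labels_def by blast
  have mrpd: "P \<in> MRPD v \<longleftrightarrow> is_pipe_dream (length v) P \<and>
      (\<forall>i k. 1 \<le> i \<and> 1 \<le> k \<and> P (i,k) = Cross \<longrightarrow> T i k < R i k) \<and> exit_labels v R \<and> markings_ok v P"
    unfolding MRPD_def reduced_def mem_Collect_eq crossing_once_iff exits_iff[OF refl v] exit_labels_def
    by (simp only: conj_ac)
  show ?thesis
  proof (cases "\<forall>i k. 1 \<le> i \<and> 1 \<le> k \<and> P (i,k) = Cross \<longrightarrow> T i k < R i k")
    case red: True
    then have "\<And>i k. 1 \<le> i \<Longrightarrow> 1 \<le> k \<Longrightarrow> P (i,k) = Cross \<Longrightarrow> T i k < R i k" by blast
    from markings_iff[OF this refl] show ?thesis unfolding mrpd good by blast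
  next
    case False
    then show ?thesis unfolding mrpd good by blast
  qed
next
  case False
  then show ?thesis unfolding MRPD_def reduced_def mem_Collect_eq by blast
qed

section \<open>Inserting and removing a pipe\<close>

text \<open>Here h c, for c < C, is the row in which the pipe entering column C crosses the border
  between the columns c and c + 1; in particular h 0 is its exit row.\<close>

definition insert_pipe :: "nat \<Rightarrow> (nat \<Rightarrow> nat) \<Rightarrow> pd \<Rightarrow> pd" where
  "insert_pipe C h Q = (\<lambda>(i,c).
     if i = 0 \<or> c = 0 then Bump False
     else if C < c then Q (i, c-1)
     else if c = C then (if i < h (C-1) then Cross else Bump False)
     else if i < h c then Q (i,c)
     else if h (c-1) < i then Q (i-1,c)
     else if h (c-1) = h c then Cross else Bump False)"

text \<open>The formula of \<open>phi1\<close> with an explicit path \<open>h\<close> in place of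
  the definite description of the entry row.\<close>

definition remove_pipe :: "nat \<Rightarrow> (nat \<Rightarrow> nat) \<Rightarrow> pd \<Rightarrow> pd" where
  "remove_pipe C h P = (\<lambda>(i,c).
     if i = 0 \<or> c = 0 then Bump False
     else if C \<le> c then P (i, c+1)
     else if i < h c then P (i,c)
     else if i = h c \<and> P (h c,c) \<noteq> Cross then Bump False
     else P (i+1,c))"

text \<open>With x = \<open>h (c-1)\<close>, both alternatives test the same tile
  \<open>Q (x - 1, c)\<close>: an unmarked bump is split, anything else is passed by a crossing
  placed below it. This makes the path deterministic from left to right and builds in the condition
  on the tile above a crossing of a removable pipe.\<close>

definition insertion_path :: "nat \<Rightarrow> (nat \<Rightarrow> nat) \<Rightarrow> pd \<Rightarrow> bool" where
  "insertion_path C h Q \<longleftrightarrow> (\<forall>c<C. 1 \<le> h c) \<and>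
     (\<forall>c. 1 \<le> c \<and> c < C \<longrightarrow>
        h (c-1) = h c \<and> (h c = 1 \<or> Q (h c - 1, c) \<noteq> Bump False) \<or>
        h (c-1) = Suc (h c) \<and> Q (h c, c) = Bump False)"

text \<open>The same path seen in the larger pipe dream. The condition on column \<open>C\<close>
  runs over all rows, since tiles outside the staircase are unmarked bumps as well.\<close>

definition removal_path :: "nat \<Rightarrow> (nat \<Rightarrow> nat) \<Rightarrow> pd \<Rightarrow> bool" where
  "removal_path C h P \<longleftrightarrow> (\<forall>c<C. 1 \<le> h c) \<and>
     (\<forall>i\<ge>1. P (i,C) = (if i < h (C-1) then Cross else Bump False)) \<and>
     (\<forall>c. 1 \<le> c \<and> c < C \<longrightarrow>
        h (c-1) = h c \<and> P (h c, c) = Cross \<and> (h c = 1 \<or> P (h c - 1, c) \<noteq> Bump False) \<or>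
        h (c-1) = Suc (h c) \<and> P (h c, c) = Bump False \<and> P (Suc (h c), c) = Bump False)"

lemma insertion_pathD:
  assumes "insertion_path C h Q" "1 \<le> c" "c < C"
  shows "1 \<le> h c" "h (c-1) = h c \<and> (h c = 1 \<or> Q (h c - 1, c) \<noteq> Bump False) \<or>
        h (c-1) = Suc (h c) \<and> Q (h c, c) = Bump False"
  using assms unfolding insertion_path_def by blast+

lemma removal_pathD:
  assumes "removal_path C h P" "1 \<le> c" "c < C"
  shows "1 \<le> h c" "h (c-1) = h c \<and> P (h c, c) = Cross \<and> (h c = 1 \<or> P (h c - 1, c) \<noteq> Bump False) \<or>
        h (c-1) = Suc (h c) \<and> P (h c, c) = Bump False \<and> P (Suc (h c), c) = Bump False"
  using assms unfolding removal_path_def by blast+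

lemma insert_pipe_right: "1 \<le> i \<Longrightarrow> C < c \<Longrightarrow> insert_pipe C h Q (i,c) = Q (i, c-1)"
  and insert_pipe_col: "1 \<le> i \<Longrightarrow> 1 \<le> C \<Longrightarrow> insert_pipe C h Q (i,C) = (if i < h (C-1) then Cross else Bump False)"
  by (auto simp: insert_pipe_def)

lemma insert_pipe_left:
  assumes "insertion_path C h Q" "1 \<le> c" "c < C"
  shows "1 \<le> i \<Longrightarrow> i < h c \<Longrightarrow> insert_pipe C h Q (i,c) = Q (i,c)"
    "h (c-1) < i \<Longrightarrow> insert_pipe C h Q (i,c) = Q (i-1,c)"
    "h (c-1) = h c \<Longrightarrow> insert_pipe C h Q (h c,c) = Cross"
    "h (c-1) = Suc (h c) \<Longrightarrow> insert_pipe C h Q (h c,c) = Bump False"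
    "h (c-1) = Suc (h c) \<Longrightarrow> insert_pipe C h Q (Suc (h c),c) = Bump False"
  using insertion_pathD[OF assms] assms(2,3) by (auto simp: insert_pipe_def)

lemma remove_insert_pipe:
  assumes path: "insertion_path C h Q" and zero: "\<And>k. Q (0,k) = Bump False" "\<And>i. Q (i,0) = Bump False"
    and C: "1 \<le> C"
  shows "remove_pipe C h (insert_pipe C h Q) = Q"
proof (intro ext, clarify)
  fix i c
  show "remove_pipe C h (insert_pipe C h Q) (i,c) = Q (i,c)"
  proof (cases "1 \<le> i \<and> 1 \<le> c \<and> c < C")
    case False
    then show ?thesis using zero C by (auto simp: remove_pipe_def insert_pipe_def)
  next
    case True
    then have ic: "1 \<le> i" "1 \<le> c" "c < C" by auto
    note l = insert_pipe_left[OF path ic(2,3)] and d = insertion_pathD[OF path ic(2,3)]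
    consider (above) "i < h c" | (cross) "h (c-1) = h c" "h c \<le> i"
      | (bump) "h (c-1) = Suc (h c)" "i = h c" | (below) "h (c-1) = Suc (h c)" "h c < i"
      using d by linarith
    then show ?thesis
    proof cases
      case above
      then show ?thesis using l(1)[OF ic(1)] ic by (simp add: remove_pipe_def)
    next
      case cross
      then show ?thesis using l(2)[of "Suc i"] l(3) ic by (simp add: remove_pipe_def)
    next
      case bump
      then show ?thesis using l(4) d ic by (auto simp add: remove_pipe_def)
    next
      case below
      then show ?thesis using l(2)[of "Suc i"] ic by (simp add: remove_pipe_def)
    qed
  qed
qed

text \<open>Tiles above the path do not move, and two adjacent bumps of the path merge into one
  unmarked bump at \<open>h c\<close>; so the test tile of \<open>insertion_path\<close> has the
  required value after removal.\<close>

lemma insert_remove_pipe: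
  assumes path: "removal_path C h P" and zero: "\<And>k. P (0,k) = Bump False" "\<And>i. P (i,0) = Bump False"
    and C: "1 \<le> C"
  shows "insert_pipe C h (remove_pipe C h P) = P" and "insertion_path C h (remove_pipe C h P)"
proof -
  show "insert_pipe C h (remove_pipe C h P) = P"
  proof (intro ext, clarify)
    fix i c
    show "insert_pipe C h (remove_pipe C h P) (i,c) = P (i,c)"
    proof (cases "1 \<le> i \<and> 1 \<le> c \<and> c < C")
      case False
      have col: "P (i,C) = (if i < h (C-1) then Cross else Bump False)" if "1 \<le> i"
        using path that unfolding removal_path_def by blast
      consider "i = 0" | "c = 0" | "1 \<le> i" "C < c" | "1 \<le> i" "c = C" using False by linarith
      then show ?thesis
      proof cases
        case 3
        then have "C \<le> c - 1" "0 < c - 1" using C by auto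
        with 3 show ?thesis by (simp add: remove_pipe_def insert_pipe_def)
      next
        case 4
        with col C show ?thesis by (simp add: insert_pipe_def)
      qed (use zero C in \<open>simp_all add: remove_pipe_def insert_pipe_def\<close>)
    next
      case True
      then have ic: "1 \<le> i" "1 \<le> c" "c < C" by auto
      note d = removal_pathD[OF path ic(2,3)]
      consider (above) "i < h c" | (below) "h (c-1) < i" | (cross) "h (c-1) = h c" "i = h c"
        | (bump1) "h (c-1) = Suc (h c)" "i = h c" | (bump2) "h (c-1) = Suc (h c)" "i = Suc (h c)"
        using d by linarith
      then show ?thesis
      proof cases
        case below
        then have "\<not> i < h c" "\<not> i - 1 < h c" "i - 1 \<noteq> h c \<or> P (h c, c) = Cross" "1 < i" using d by auto
        then show ?thesis using below ic by (auto simp: remove_pipe_def insert_pipe_def)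
      qed (use ic d in \<open>auto simp: remove_pipe_def insert_pipe_def\<close>)
    qed
  qed
  show "insertion_path C h (remove_pipe C h P)"
    unfolding insertion_path_def
  proof (intro conjI allI impI)
    fix c assume "c < C" then show "1 \<le> h c" using path unfolding removal_path_def by blast
  next
    fix c assume c: "1 \<le> c \<and> c < C"
    then show "h (c-1) = h c \<and> (h c = 1 \<or> remove_pipe C h P (h c - 1, c) \<noteq> Bump False) \<or>
        h (c-1) = Suc (h c) \<and> remove_pipe C h P (h c, c) = Bump False"
      using removal_pathD[OF path, of c] by (auto simp: remove_pipe_def)
  qed
qed

text \<open>The increasing injection that omits \<open>C\<close>: a pipe entering column a of
  \<open>Q\<close> enters column \<open>shift C a\<close> after insertion. The same map, with
  another parameter, serves for rows and for positions in words.\<close>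

definition shift :: "nat \<Rightarrow> nat \<Rightarrow> nat" where
  "shift C a = (if a < C then a else Suc a)"

lemma shift_less_iff: "shift C a < shift C b \<longleftrightarrow> a < b"
  and shift_eq_iff: "shift C a = shift C b \<longleftrightarrow> a = b"
  and shift_neq: "shift C a \<noteq> C" "C \<noteq> shift C a"
  and shift_less: "shift C a < C \<longleftrightarrow> a < C"
  and shift_greater: "C < shift C a \<longleftrightarrow> C \<le> a"
  by (auto simp: shift_def)

text \<open>For c < C the label \<open>C\<close> on a top edge arises only where the path descends:
  it is the edge between the two new bumps. In column \<open>C\<close> below the path all tiles are
  bumps, so the top labels are right labels from one row higher.\<close>

definition insert_top :: "nat \<Rightarrow> (nat \<Rightarrow> nat) \<Rightarrow> (nat \<Rightarrow> nat \<Rightarrow> nat) \<Rightarrow> (nat \<Rightarrow> nat \<Rightarrow> nat) \<Rightarrow> nat \<Rightarrow> nat \<Rightarrow> nat" where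
  "insert_top C h T R i c =
     (if C < c then shift C (T i (c-1))
      else if c = C then (if i \<le> h (C-1) then C else shift C (R (i-1) (C-1)))
      else if i \<le> h c then shift C (T i c)
      else if i \<le> h (c-1) then C else shift C (T (i-1) c))"

definition insert_right :: "nat \<Rightarrow> (nat \<Rightarrow> nat) \<Rightarrow> (nat \<Rightarrow> nat \<Rightarrow> nat) \<Rightarrow> nat \<Rightarrow> nat \<Rightarrow> nat" where
  "insert_right C h R i c =
     (if C \<le> c then shift C (R i (c-1))
      else if i < h c then shift C (R i c)
      else if i = h c then C else shift C (R (i-1) c))"

lemma insert_right_eq_iff: "c < C \<Longrightarrow> insert_right C h R i c = C \<longleftrightarrow> i = h c"
  by (auto simp: insert_right_def shift_neq)

text \<open>At a split bump the upper new bump sends the old top label left and the lower one sends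
  the old right label down, which is what the single bump of \<open>Q\<close> did.\<close>

lemma labelling_insert_pipe:
  assumes lab: "labelling Q T R" and path: "insertion_path C h Q" and C: "1 \<le> C"
  shows "labelling (insert_pipe C h Q) (insert_top C h T R) (insert_right C h R)" (is "labelling ?P ?T ?R")
proof -
  have top: "?T 1 k = k" if k: "1 \<le> k" for k
  proof -
    have "1 \<le> h c" if "c < C" for c using path that unfolding insertion_path_def by blast
    from this[of k] this[of "C-1"] C k labelling_top[OF lab, of k] labelling_top[OF lab, of "k-1"]
    show ?thesis by (cases "k < C"; cases "k = C") (auto simp: insert_top_def shift_def)
  qed
  have rule: "if ?P (i,k) = Cross then ?T (i+1) k = ?T i k \<and> ?R i (k-1) = ?R i k
         else ?T (i+1) k = ?R i k \<and> ?R i (k-1) = ?T i k" if ik: "1 \<le> i" "1 \<le> k" for i k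
  proof -
    consider (right) "C < k" | (col) "k = C" | (left) "k < C" by linarith
    then show ?thesis
    proof cases
      case right
      then have k: "1 \<le> k - 1" using C by auto
      have "?P (i,k) = Q (i,k-1)" using insert_pipe_right[OF ik(1) right] .
      moreover have "?T (i+1) k = shift C (T (i+1) (k-1))" "?T i k = shift C (T i (k-1))"
        "?R i k = shift C (R i (k-1))" "?R i (k-1) = shift C (R i (k-1-1))"
        using right by (auto simp: insert_top_def insert_right_def)
      ultimately show ?thesis
        using labelling_Cross[OF lab ik(1) k] labelling_Bump[OF lab ik(1) k] by simp
    next
      case col
      have "?P (i,C) = (if i < h (C-1) then Cross else Bump False)" using insert_pipe_col ik C by blast
      then show ?thesis using col C
        by (auto simp: insert_top_def insert_right_def)
    next
      case left
      note l = insert_pipe_left[OF path ik(2) left] and d = insertion_pathD[OF path ik(2) left]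
      have k1: "\<not> C \<le> k - 1" using left by auto
      consider (above) "i < h k" | (below) "h (k-1) < i" | (cross) "h (k-1) = h k" "i = h k"
        | (bump1) "h (k-1) = Suc (h k)" "i = h k" | (bump2) "h (k-1) = Suc (h k)" "i = Suc (h k)"
        using d by linarith
      then show ?thesis
      proof cases
        case above
        have "i < h (k-1)" using above d by auto
        then show ?thesis using above left k1 l(1)[OF ik(1) above]
            labelling_Cross[OF lab ik] labelling_Bump[OF lab ik]
          by (simp add: insert_top_def insert_right_def)
      next
        case below
        then have i: "1 \<le> i - 1" "h k < i" "\<not> i \<le> h k" "\<not> i < h k" "i \<noteq> h k" "\<not> i \<le> h (k-1)"
           "\<not> i < h (k-1)" "i \<noteq> h (k-1)" "Suc (i - 1) = i" "\<not> Suc i \<le> h k" "\<not> Suc i \<le> h (k-1)" using d by auto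
        show ?thesis using i(2-) left k1 l(2)[OF below]
            labelling_Cross[OF lab i(1) ik(2)] labelling_Bump[OF lab i(1) ik(2)]
          by (simp add: insert_top_def insert_right_def)
      next
        case cross
        then show ?thesis using l(3) left k1 by (simp add: insert_top_def insert_right_def)
      next
        case bump1
        have "Q (h k, k) = Bump False" using d bump1 by auto
        then show ?thesis using l(4) bump1 left k1 labelling_Bump[OF lab ik] by (simp add: insert_top_def insert_right_def)
      next
        case bump2
        have "Q (h k, k) = Bump False" using d bump2 by auto
        then show ?thesis using l(5) bump2 left k1 labelling_Bump[OF lab d(1) ik(2)] by (simp add: insert_top_def insert_right_def)
      qed
    qed
  qed
  show ?thesis unfolding labelling_def using top rule by blast
qed

section \<open>The staircase shape under insertion and removal\<close>

lemma pd_insert_pipe: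
  assumes pd: "is_pipe_dream m Q" and path: "insertion_path C h Q" and C: "1 \<le> C" "C \<le> Suc m"
    and bound: "\<And>c. c < C \<Longrightarrow> h c + c \<le> Suc m"
  shows "is_pipe_dream (Suc m) (insert_pipe C h Q)"
proof -
  have B: "insert_pipe C h Q (i,c) = Bump False" if "Suc m + 1 < i + c" "1 \<le> i" "1 \<le> c" for i c
  proof -
    consider (right) "C < c" | (col) "c = C" | (left) "c < C" by linarith
    then show ?thesis
    proof cases
      case right
      then show ?thesis using insert_pipe_right[of i C c h Q] that pd_outside[OF pd, of i "c-1"] by auto
    next
      case col
      then show ?thesis using insert_pipe_col[of i C h Q] that C bound[of "C-1"] by auto
    next
      case left
      then have "c - 1 < C" by auto
      then have "h (c-1) < i" using bound[of "c-1"] that by auto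
      then show ?thesis using insert_pipe_left(2)[OF path _ left, of i] that pd_outside[OF pd, of "i-1" c] by auto
    qed
  qed
  have D: "insert_pipe C h Q (i,c) \<noteq> Cross" if "Suc m + 1 = i + c" "1 \<le> i" "1 \<le> c" for i c
  proof -
    consider (right) "C < c" | (col) "c = C" | (left) "c < C" by linarith
    then show ?thesis
    proof cases
      case right
      then show ?thesis using insert_pipe_right[of i C c h Q] that pd_not_Cross[OF pd, of i "c-1"] by auto
    next
      case col
      then show ?thesis using insert_pipe_col[of i C h Q] that C bound[of "C-1"] by auto
    next
      case left
      note d = insertion_pathD[OF path that(3) left]
      have "c - 1 < C" using left by auto
      \<comment> \<open>On the outer diagonal the row i is strictly below \<open>h c\<close>, so no
        new crossing lies on it.\<close>
      then have "h (c-1) \<le> i" "h c < i" using bound[of "c-1"] bound[of c] that left by auto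
      then consider "h (c-1) < i" | "h (c-1) = Suc (h c)" "i = Suc (h c)" using d by linarith
      then show ?thesis
      proof cases
        case 1
        then show ?thesis using insert_pipe_left(2)[OF path _ left, of i] that pd_not_Cross[OF pd, of "i-1" c] by auto
      next
        case 2
        then show ?thesis using insert_pipe_left(5)[OF path _ left] that by auto
      qed
    qed
  qed
  have Z: "insert_pipe C h Q (0,c) = Bump False" "insert_pipe C h Q (i,0) = Bump False" for i c
    by (auto simp: insert_pipe_def)
  show ?thesis
    unfolding is_pipe_dream_def
  proof (intro conjI allI impI)
    fix p :: "nat \<times> nat" assume p: "p \<notin> staircase (Suc m)"
    obtain i c where "p = (i,c)" by (cases p)
    then show "insert_pipe C h Q p = Bump False" using p Z B[of i c] by (cases "i = 0"; cases "c = 0") (auto simp: staircase_def)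
  next
    fix i assume "1 \<le> i \<and> i \<le> Suc m"
    then have "Suc m + 1 = i + (Suc m + 1 - i)" "1 \<le> i" "1 \<le> Suc m + 1 - i" by auto
    then show "insert_pipe C h Q (i, Suc m + 1 - i) \<noteq> Cross" by (rule D)
  qed
qed

lemma pd_remove_pipe:
  assumes pd: "is_pipe_dream (Suc m) P" and path: "removal_path C h P" and C: "1 \<le> C" "C \<le> Suc m"
    and bound: "\<And>c. c < C \<Longrightarrow> h c + c \<le> Suc m"
  shows "is_pipe_dream m (remove_pipe C h P)"
proof -
  have B: "remove_pipe C h P (i,c) = Bump False" if "m + 1 < i + c" "1 \<le> i" "1 \<le> c" for i c
  proof (cases "c < C")
    case False
    then show ?thesis using that pd_outside[OF pd, of i "c+1"] by (auto simp: remove_pipe_def)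
  next
    case True
    then have "\<not> i < h c" using bound[of c] that by auto
    then show ?thesis using that True pd_outside[OF pd, of "i+1" c] by (auto simp: remove_pipe_def)
  qed
  have D: "remove_pipe C h P (i,c) \<noteq> Cross" if "m + 1 = i + c" "1 \<le> i" "1 \<le> c" for i c
  proof (cases "c < C")
    case False
    then show ?thesis using that pd_not_Cross[OF pd, of i "c+1"] by (auto simp: remove_pipe_def)
  next
    case True
    then have "\<not> i < h c" using bound[of c] that by auto
    then show ?thesis using that True pd_not_Cross[OF pd, of "i+1" c] by (auto simp: remove_pipe_def)
  qed
  have Z: "remove_pipe C h P (0,c) = Bump False" "remove_pipe C h P (i,0) = Bump False" for i c
    by (auto simp: remove_pipe_def)
  show ?thesis
    unfolding is_pipe_dream_def
  proof (intro conjI allI impI)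
    fix p :: "nat \<times> nat" assume p: "p \<notin> staircase m"
    obtain i c where "p = (i,c)" by (cases p)
    then show "remove_pipe C h P p = Bump False" using p Z B[of i c] by (cases "i = 0"; cases "c = 0") (auto simp: staircase_def)
  next
    fix i assume "1 \<le> i \<and> i \<le> m"
    then have "m + 1 = i + (m + 1 - i)" "1 \<le> i" "1 \<le> m + 1 - i" by auto
    then show "remove_pipe C h P (i, m + 1 - i) \<noteq> Cross" by (rule D)
  qed
qed

text \<open>\<open>shift\<close> preserves order, so old tiles keep their conditions. In column
  \<open>C\<close> the new pipe comes from the top and meets a label from further right, which is
  larger. Left of it the new pipe comes from the right, and only there is a condition on the label
  above it left over.\<close>

lemma good_labels_insert_pipe:
  assumes L: "labelled_pd m Q T R" and path: "insertion_path C h Q" and C: "1 \<le> C"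
  shows "good_labels (insert_pipe C h Q) (insert_top C h T R) (insert_right C h R) \<longleftrightarrow>
    good_labels Q T R \<and> (\<forall>c. 1 \<le> c \<and> c < C \<and> h (c-1) = h c \<longrightarrow> T (h c) c < C)"
    (is "good_labels ?P ?T ?R \<longleftrightarrow> _")
proof
  interpret labelled_pd m Q T R by (rule L)
  assume good: "good_labels ?P ?T ?R"
  have Q: "(Q (i,k) = Cross \<longrightarrow> T i k < R i k) \<and> (Q (i,k) = Bump True \<longrightarrow> R i k < T i k)"
    if ik: "1 \<le> i" "1 \<le> k" for i k
  proof -
    consider (right) "C \<le> k" | (left) "k < C" by linarith
    then show ?thesis
    proof cases
      case right
      then have "?P (i,Suc k) = Q (i,k)" using insert_pipe_right[of i C "Suc k"] ik by simp
      moreover have "?T i (Suc k) = shift C (T i k)" "?R i (Suc k) = shift C (R i k)"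
        using right by (auto simp: insert_top_def insert_right_def)
      ultimately show ?thesis using good ik unfolding good_labels_def
        by (metis shift_less_iff le_SucI)
    next
      case left
      note l = insert_pipe_left[OF path ik(2) left] and d = insertion_pathD[OF path ik(2) left]
      consider (above) "i < h k" | (below) "h (k-1) < Suc i" "h k \<le> i" | (bump) "Q (i,k) = Bump False"
        using d by (metis linorder_not_less nat_less_le not_less_eq)
      then show ?thesis
      proof cases
        case above
        then have "?P (i,k) = Q (i,k)" "?T i k = shift C (T i k)" "?R i k = shift C (R i k)"
          using l(1)[OF ik(1)] left by (auto simp: insert_top_def insert_right_def)
        then show ?thesis using good ik unfolding good_labels_def by (metis shift_less_iff)
      next
        case below
        then have "?P (Suc i,k) = Q (i,k)" "?T (Suc i) k = shift C (T i k)" "?R (Suc i) k = shift C (R i k)"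
          using l(2)[of "Suc i"] left by (auto simp: insert_top_def insert_right_def)
        then show ?thesis using good ik unfolding good_labels_def by (metis shift_less_iff le_SucI)
      next
        case bump
        then show ?thesis by simp
      qed
    qed
  qed
  have "T (h c) c < C" if c: "1 \<le> c" "c < C" "h (c-1) = h c" for c
  proof -
    have "?P (h c, c) = Cross" "?T (h c) c = shift C (T (h c) c)" "?R (h c) c = C"
      using insert_pipe_left(3)[OF path] c by (auto simp: insert_top_def insert_right_def)
    moreover have "1 \<le> h c" using insertion_pathD(1)[OF path] c by auto
    ultimately have "shift C (T (h c) c) < C" using good c unfolding good_labels_def by metis
    then show ?thesis by (simp add: shift_less)
  qed
  with Q show "good_labels Q T R \<and> (\<forall>c. 1 \<le> c \<and> c < C \<and> h (c-1) = h c \<longrightarrow> T (h c) c < C)"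
    unfolding good_labels_def by blast
next
  interpret labelled_pd m Q T R by (rule L)
  assume "good_labels Q T R \<and> (\<forall>c. 1 \<le> c \<and> c < C \<and> h (c-1) = h c \<longrightarrow> T (h c) c < C)"
  then have good: "good_labels Q T R" and X: "\<And>c. 1 \<le> c \<Longrightarrow> c < C \<Longrightarrow> h (c-1) = h c \<Longrightarrow> T (h c) c < C"
    by auto
  have "(?P (i,k) = Cross \<longrightarrow> ?T i k < ?R i k) \<and> (?P (i,k) = Bump True \<longrightarrow> ?R i k < ?T i k)"
    if ik: "1 \<le> i" "1 \<le> k" for i k
  proof -
    consider (right) "C < k" | (col) "k = C" | (left) "k < C" by linarith
    then show ?thesis
    proof cases
      case right
      then have "?P (i,k) = Q (i,k-1)" "1 \<le> k - 1" using insert_pipe_right[of i C k] ik C by auto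
      moreover have "?T i k = shift C (T i (k-1))" "?R i k = shift C (R i (k-1))"
        using right by (auto simp: insert_top_def insert_right_def)
      ultimately show ?thesis using good ik unfolding good_labels_def by (metis shift_less_iff)
    next
      case col
      have "C \<le> R i (C-1)" using R_gt[OF ik(1), of "C-1"] C by auto
      then show ?thesis using col insert_pipe_col[of i C h Q] ik C
        by (auto simp: insert_top_def insert_right_def shift_greater)
    next
      case left
      note l = insert_pipe_left[OF path ik(2) left] and d = insertion_pathD[OF path ik(2) left]
      consider (above) "i < h k" | (below) "h (k-1) < i" | (cross) "h (k-1) = h k" "i = h k"
        | (bump1) "h (k-1) = Suc (h k)" "i = h k" | (bump2) "h (k-1) = Suc (h k)" "i = Suc (h k)"
        using d by linarith
      then show ?thesis
      proof cases
        case above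
        then have "?P (i,k) = Q (i,k)" "?T i k = shift C (T i k)" "?R i k = shift C (R i k)"
          using l(1)[OF ik(1)] left by (auto simp: insert_top_def insert_right_def)
        then show ?thesis using good ik unfolding good_labels_def by (metis shift_less_iff)
      next
        case below
        then have "1 \<le> i - 1" "?P (i,k) = Q (i-1,k)" "?T i k = shift C (T (i-1) k)" "?R i k = shift C (R (i-1) k)"
          using l(2)[of i] left d by (auto simp: insert_top_def insert_right_def)
        then show ?thesis using good ik unfolding good_labels_def by (metis shift_less_iff)
      next
        case cross
        then have "?P (i,k) = Cross" "?T i k = shift C (T i k)" "?R i k = C"
          using l(3) left by (auto simp: insert_top_def insert_right_def)
        then show ?thesis using X[OF ik(2) left cross(1)] cross(2) by (simp add: shift_less)
      qed (use l in simp_all)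
    qed
  qed
  then show "good_labels ?P ?T ?R" unfolding good_labels_def by blast
qed

section \<open>Words with one entry deleted\<close>

lemma remove1_nth:
  assumes "distinct v" "p < length v" "v ! p = j" "i < length v - 1"
  shows "remove1 j v ! i = v ! (shift p i)"
proof -
  have "j \<notin> set (take p v)"
    using assms(1-3) by (auto simp: in_set_conv_nth distinct_conv_nth)
  moreover have "v = take p v @ j # drop (Suc p) v" using assms(2,3) id_take_nth_drop by blast
  ultimately have "remove1 j v = take p v @ drop (Suc p) v" by (metis remove1.simps(2) remove1_append)
  then show ?thesis using assms by (auto simp: nth_append shift_def)
qed

lemma col_spec:
  assumes v: "distinct v" and j: "j \<in> set v"
  shows "1 \<le> col v j" "col v j \<le> length v" "sort v ! (col v j - 1) = j"
    and "\<And>k. 1 \<le> k \<Longrightarrow> k \<le> length v \<Longrightarrow> sort v ! (k - 1) = j \<Longrightarrow> col v j = k"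
proof -
  have uniq: "k = l" if "1 \<le> k" "k \<le> length v" "sort v ! (k - 1) = j" "1 \<le> l" "l \<le> length v" "sort v ! (l - 1) = j" for k l
  proof -
    have "k - 1 < length v" "l - 1 < length v" using that by auto
    then have "k - 1 = l - 1" using nth_eq_iff_index_eq[of "sort v" "k-1" "l-1"] v that by simp
    then show ?thesis using that by auto
  qed
  have "j \<in> set (sort v)" using j by simp
  then obtain l where "l < length v" "sort v ! l = j" unfolding in_set_conv_nth length_sort by blast
  then have ex: "1 \<le> Suc l \<and> Suc l \<le> length v \<and> sort v ! (Suc l - 1) = j" by simp
  have "1 \<le> col v j \<and> col v j \<le> length v \<and> sort v ! (col v j - 1) = j"
    unfolding col_def
  proof (rule theI[of _ "Suc l"], rule ex)
    fix k assume "1 \<le> k \<and> k \<le> length v \<and> sort v ! (k - 1) = j"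
    then show "k = Suc l" using uniq[of k "Suc l"] ex by simp
  qed
  then show "1 \<le> col v j" "col v j \<le> length v" "sort v ! (col v j - 1) = j" by auto
  then show "col v j = k" if "1 \<le> k" "k \<le> length v" "sort v ! (k - 1) = j" for k
    using that uniq by metis
qed

lemma sort_remove1:
  fixes v :: "nat list"
  assumes "distinct v"
  shows "sort (remove1 j v) = remove1 j (sort v)"
  by (rule sorted_distinct_set_unique) (use assms in \<open>auto simp: sorted_remove1\<close>)

lemma sort_remove1_nth:
  assumes v: "distinct v" and j: "j \<in> set v" and a: "1 \<le> a" "a < length v"
  shows "sort (remove1 j v) ! (a - 1) = sort v ! (shift (col v j) a - 1)"
proof -
  have "remove1 j (sort v) ! (a - 1) = sort v ! (shift (col v j - 1) (a - 1))"
    by (rule remove1_nth) (use col_spec(1-3)[OF v j] v a in auto)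
  moreover have "shift (col v j - 1) (a - 1) = shift (col v j) a - 1"
    using a col_spec(1)[OF v j] by (auto simp: shift_def)
  ultimately show ?thesis using sort_remove1[OF v] by simp
qed

lemma col_remove1:
  assumes v: "distinct v" and j: "j \<in> set v" and j': "j' \<in> set v" "j' \<noteq> j"
  shows "col v j' = shift (col v j) (col (remove1 j v) j')"
proof -
  have j'': "j' \<in> set (remove1 j v)" "distinct (remove1 j v)" using v j' by auto
  note c = col_spec[OF j''(2,1)]
  have len: "length (remove1 j v) = length v - 1" using j by (simp add: length_remove1)
  show ?thesis
  proof (rule col_spec(4)[OF v j'(1)])
    have a: "1 \<le> col (remove1 j v) j'" "col (remove1 j v) j' < length v" using c(1,2) len by auto
    then show "1 \<le> shift (col v j) (col (remove1 j v) j')" "shift (col v j) (col (remove1 j v) j') \<le> length v"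
      by (auto simp: shift_def)
    show "sort v ! (shift (col v j) (col (remove1 j v) j') - 1) = j'"
      using sort_remove1_nth[OF v j a] c(3) by simp
  qed
qed

text \<open>Row \<open>p\<close> is the exit of the inserted pipe and is correct by the choice of
  \<open>p\<close>; the other rows correspond under \<open>shift p\<close> and their labels under
  \<open>shift C\<close>.\<close>

lemma exit_labels_insert_pipe:
  assumes v: "distinct v" and p: "1 \<le> p" "p \<le> length v" "v ! (p-1) = j" and C: "C = col v j" and h: "h 0 = p"
    and L: "labelled_pd (length v - 1) Q T R"
  shows "exit_labels v (insert_right C h R) \<longleftrightarrow> exit_labels (remove1 j v) R"
proof -
  interpret labelled_pd "length v - 1" Q T R by (rule L)
  have j: "j \<in> set v" using p by auto
  have len: "length (remove1 j v) = length v - 1" using j by (simp add: length_remove1)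
  have C1: "1 \<le> C" using col_spec(1)[OF v j] C by simp
  have b: "1 \<le> R i 0" "R i 0 < length v" if "1 \<le> i" "i \<le> length v - 1" for i
    using R_gt[of i 0] R_inside[of i 0] that by auto
  have up: "remove1 j v ! (i-1) = v ! (shift p i - 1)"
      "sort (remove1 j v) ! (R i 0 - 1) = sort v ! (insert_right C h R (shift p i) 0 - 1)"
    if i: "1 \<le> i" "i \<le> length v - 1" for i
  proof -
    have "remove1 j v ! (i-1) = v ! (shift (p-1) (i-1))" by (rule remove1_nth) (use v p i in auto)
    moreover have "shift (p-1) (i-1) = shift p i - 1" using p i by (auto simp: shift_def)
    ultimately show "remove1 j v ! (i-1) = v ! (shift p i - 1)" by simp
    have "insert_right C h R (shift p i) 0 = shift C (R i 0)"
      using C1 h by (auto simp: insert_right_def shift_def)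
    then show "sort (remove1 j v) ! (R i 0 - 1) = sort v ! (insert_right C h R (shift p i) 0 - 1)"
      using sort_remove1_nth[OF v j b[OF i]] C by simp
  qed
  show ?thesis
  proof
    assume E: "exit_labels v (insert_right C h R)"
    show "exit_labels (remove1 j v) R"
      unfolding exit_labels_def len
    proof (intro allI impI)
      fix i assume i: "1 \<le> i \<and> i \<le> length v - 1"
      then have "1 \<le> shift p i" "shift p i \<le> length v" by (auto simp: shift_def)
      with E up i show "remove1 j v ! (i-1) = sort (remove1 j v) ! (R i 0 - 1)"
        unfolding exit_labels_def by metis
    qed
  next
    assume E: "exit_labels (remove1 j v) R"
    show "exit_labels v (insert_right C h R)"
      unfolding exit_labels_def
    proof (intro allI impI)
      fix i assume i: "1 \<le> i \<and> i \<le> length v"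
      show "v ! (i-1) = sort v ! (insert_right C h R i 0 - 1)"
      proof (cases "i = p")
        case True
        then have "insert_right C h R i 0 = C" using h C1 by (auto simp: insert_right_def)
        then show ?thesis using True p col_spec(3)[OF v j] C by simp
      next
        case False
        \<comment> \<open>The preimage of i under \<open>shift p\<close>.\<close>
        define i' where "i' = (if i < p then i else i - 1)"
        have i': "1 \<le> i'" "i' \<le> length v - 1" "shift p i' = i"
          using False i p by (auto simp: i'_def shift_def)
        then show ?thesis using up[OF i'(1,2)] E len unfolding exit_labels_def by metis
      qed
    qed
  qed
qed

section \<open>Removability in terms of labels\<close>

definition removable_at :: "pd \<Rightarrow> (nat \<Rightarrow> nat \<Rightarrow> nat) \<Rightarrow> (nat \<Rightarrow> nat \<Rightarrow> nat) \<Rightarrow> nat \<Rightarrow> bool" where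
  "removable_at P T R C \<longleftrightarrow>
     (\<exists>r. \<forall>i\<ge>1. P (i,C) = (if i \<le> r then Cross else Bump False)) \<and>
     (\<forall>i k. 1 \<le> i \<and> 1 \<le> k \<and> (T i k = C \<or> R i k = C) \<longrightarrow>
        P (i,k) \<noteq> Bump True \<and> (P (i,k) = Cross \<and> 2 \<le> i \<longrightarrow> P (i-1,k) \<noteq> Bump False))"

text \<open>Pipe \<open>C\<close> enters at the top of its column and runs straight down through the
  leading crossings, which yields the traversal clause of \<open>removable\<close>.\<close>

lemma removable_iff:
  assumes L: "labelled_pd (length v) P T R" and v: "distinct v" and j: "j \<in> set v"
  shows "removable v P j \<longleftrightarrow> removable_at P T R (col v j)"
proof -
  interpret labelled_pd "length v" P T R by (rule L)
  let ?C = "col v j"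
  note C = col_spec(1,2)[OF v j]
  have T: "T i ?C = ?C" if "\<forall>i. 1 \<le> i \<and> i \<le> r \<longrightarrow> P (i,?C) = Cross" "1 \<le> i" "i \<le> Suc r" for i r
    using that(2,3)
  proof (induction i rule: dec_induct)
    case base
    then show ?case using labelling_top[OF lab] C by simp
  next
    case (step i)
    then show ?case using Cross_simps(2)[of i ?C] that(1) C by simp
  qed
  have col: "(\<forall>i. 1 \<le> i \<and> i \<le> r \<longrightarrow> P (i, ?C) = Cross \<and> traverses P ?C (i, ?C)) \<and>
            (\<forall>i. r < i \<and> i + ?C \<le> length v + 1 \<longrightarrow> P (i, ?C) = Bump False)
      \<longleftrightarrow> (\<forall>i\<ge>1. P (i,?C) = (if i \<le> r then Cross else Bump False))" (is "?A \<longleftrightarrow> ?B") for r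
  proof
    assume A: ?A
    show ?B
    proof (intro allI impI)
      fix i :: nat assume "1 \<le> i"
      then show "P (i,?C) = (if i \<le> r then Cross else Bump False)"
        using A pd_outside[OF pd, of i ?C] by (cases "i \<le> r"; cases "i + ?C \<le> length v + 1") auto
    qed
  next
    assume B: ?B
    then have cr: "\<forall>i. 1 \<le> i \<and> i \<le> r \<longrightarrow> P (i,?C) = Cross" by simp
    have "traverses P ?C (i, ?C)" if "1 \<le> i" "i \<le> r" for i
      using T[OF cr, of i] that C traverses_iff[OF C(1), of i ?C] by simp
    then show ?A using B cr by simp
  qed
  have trav: "(\<forall>i k. traverses P ?C (i,k) \<and> P (i,k) = Cross \<and> 2 \<le> i \<longrightarrow> P (i-1, k) \<noteq> Bump False) \<and>
       (\<forall>p. traverses P ?C p \<longrightarrow> P p \<noteq> Bump True)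
     \<longleftrightarrow> (\<forall>i k. 1 \<le> i \<and> 1 \<le> k \<and> (T i k = ?C \<or> R i k = ?C) \<longrightarrow>
        P (i,k) \<noteq> Bump True \<and> (P (i,k) = Cross \<and> 2 \<le> i \<longrightarrow> P (i-1,k) \<noteq> Bump False))"
    unfolding split_paired_All traverses_iff[OF C(1)] by blast
  show ?thesis
    unfolding removable_def Let_def removable_at_def col trav using j by simp
qed

lemma removable_at_insert_pipe_self:
  assumes path: "insertion_path C h Q" and C: "1 \<le> C"
  shows "removable_at (insert_pipe C h Q) (insert_top C h T R) (insert_right C h R) C" (is "removable_at ?P ?T ?R C")
proof -
  have "?P (i,k) \<noteq> Bump True \<and> (?P (i,k) = Cross \<and> 2 \<le> i \<longrightarrow> ?P (i-1,k) \<noteq> Bump False)"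
    if ik: "1 \<le> i" "1 \<le> k" and lab: "?T i k = C \<or> ?R i k = C" for i k
  proof -
    consider (right) "C < k" | (col) "k = C" | (left) "k < C" by linarith
    then show ?thesis
    proof cases
      case right
      then show ?thesis using lab by (simp add: insert_top_def insert_right_def shift_neq)
    next
      case col
      have "?P (i',C) = (if i' < h (C-1) then Cross else Bump False)" if "1 \<le> i'" for i'
        using insert_pipe_col that C by blast
      from this[of i] this[of "i-1"] show ?thesis using ik col by auto
    next
      case left
      note l = insert_pipe_left[OF path ik(2) left] and d = insertion_pathD[OF path ik(2) left]
      have "i = h k \<or> h (k-1) = Suc (h k) \<and> i = Suc (h k)"
        using lab left d by (auto simp: insert_top_def insert_right_def shift_neq split: if_splits)
      then consider (cross) "h (k-1) = h k" "i = h k" | (bump) "h (k-1) = Suc (h k)" "i = h k \<or> i = Suc (h k)"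
        using d by auto
      then show ?thesis
      proof cases
        case cross
        then show ?thesis using l(1)[of "i-1"] l(3) d by auto
      next
        case bump
        then show ?thesis using l(4,5) by auto
      qed
    qed
  qed
  moreover have "\<exists>r. \<forall>i\<ge>1. ?P (i,C) = (if i \<le> r then Cross else Bump False)"
  proof (intro exI[of _ "h (C-1) - 1"] allI impI)
    fix i :: nat assume "1 \<le> i"
    moreover have "1 \<le> h (C-1)" using path C by (auto simp: insertion_path_def)
    ultimately show "?P (i,C) = (if i \<le> h (C-1) - 1 then Cross else Bump False)"
      using insert_pipe_col[of i C h Q] C by auto
  qed
  ultimately show ?thesis unfolding removable_at_def by blast
qed

text \<open>This is what allows pipes to be removed or inserted one after the other: apart from the
  relabelling, inserting a pipe neither creates nor destroys the removability of another.\<close>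

lemma removable_at_insert_pipe:
  assumes path: "insertion_path C h Q" and C: "1 \<le> C" and C': "1 \<le> C'"
  shows "removable_at (insert_pipe C h Q) (insert_top C h T R) (insert_right C h R) (shift C C') \<longleftrightarrow>
    removable_at Q T R C'" (is "removable_at ?P ?T ?R _ \<longleftrightarrow> _")
proof -
  \<comment> \<open>Every tile of \<open>Q\<close> other than an unmarked bump survives in the new
    pipe dream, and so does an unmarked bump directly above it: a new crossing is never placed just
    below an unmarked bump.\<close>
  have M: "\<exists>i' k'. 1 \<le> i' \<and> 1 \<le> k' \<and> ?P (i',k') = Q (i,k) \<and> ?T i' k' = shift C (T i k) \<and> ?R i' k' = shift C (R i k) \<and>
     (2 \<le> i \<and> Q (i-1,k) = Bump False \<longrightarrow> 2 \<le> i' \<and> ?P (i'-1,k') = Bump False)"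
    if ik: "1 \<le> i" "1 \<le> k" and nb: "Q (i,k) \<noteq> Bump False" for i k
  proof -
    consider (right) "C \<le> k" | (left) "k < C" by linarith
    then show ?thesis
    proof cases
      case right
      have P: "?P (i',Suc k) = Q (i',k)" if "1 \<le> i'" for i'
        using insert_pipe_right[of i' C "Suc k"] that right by simp
      have "1 \<le> Suc k" "?P (i,Suc k) = Q (i,k)"
        "?T i (Suc k) = shift C (T i k)" "?R i (Suc k) = shift C (R i k)"
        "2 \<le> i \<and> Q (i-1,k) = Bump False \<longrightarrow> 2 \<le> i \<and> ?P (i-1,Suc k) = Bump False"
        using P[of i] P[of "i-1"] ik right by (auto simp add: insert_top_def insert_right_def)
      with ik show ?thesis by (intro exI[of _ i] exI[of _ "Suc k"]) simp
    next
      case left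
      note l = insert_pipe_left[OF path ik(2) left] and d = insertion_pathD[OF path ik(2) left]
      consider (above) "i < h k" | (cross) "h (k-1) = h k" "h k \<le> i" | (bump) "h (k-1) = Suc (h k)" "h k < i"
        using d nb by (metis linorder_not_less nat_less_le)
      then show ?thesis
      proof cases
        case above
        have "?P (i,k) = Q (i,k)" "?T i k = shift C (T i k)" "?R i k = shift C (R i k)"
          "2 \<le> i \<and> Q (i-1,k) = Bump False \<longrightarrow> 2 \<le> i \<and> ?P (i-1,k) = Bump False"
          using l(1)[of i] l(1)[of "i-1"] ik left above by (auto simp add: insert_top_def insert_right_def)
        with ik show ?thesis by (intro exI[of _ i] exI[of _ k]) simp
      next
        case cross
        have "?P (i,k) = Bump False" if "2 \<le> i" "Q (i-1,k) = Bump False"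
          using l(2)[of i] that d cross by (cases "i = h k") auto
        moreover have "1 \<le> Suc i" "?P (Suc i,k) = Q (i,k)" "?T (Suc i) k = shift C (T i k)" "?R (Suc i) k = shift C (R i k)"
          using l(2)[of "Suc i"] ik left cross by (simp_all add: insert_top_def insert_right_def)
        ultimately show ?thesis using ik by (intro exI[of _ "Suc i"] exI[of _ k]) simp
      next
        case bump
        have "?P (i,k) = Bump False" if "2 \<le> i" "Q (i-1,k) = Bump False"
          using l(2)[of i] l(5) that d bump by (cases "i = Suc (h k)") auto
        moreover have "1 \<le> Suc i" "?P (Suc i,k) = Q (i,k)" "?T (Suc i) k = shift C (T i k)" "?R (Suc i) k = shift C (R i k)"
          using l(2)[of "Suc i"] ik left bump by (simp_all add: insert_top_def insert_right_def)
        ultimately show ?thesis using ik by (intro exI[of _ "Suc i"] exI[of _ k]) simp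
      qed
    qed
  qed
  \<comment> \<open>Conversely each such tile comes from \<open>Q\<close>, except for the crossings
    on the new pipe, which satisfy the condition on the tile above by construction.\<close>
  have M': "(\<exists>i' k'. 1 \<le> i' \<and> 1 \<le> k' \<and> Q (i',k') = ?P (i,k) \<and> shift C (T i' k') = ?T i k \<and> shift C (R i' k') = ?R i k \<and>
     (2 \<le> i \<and> ?P (i-1,k) = Bump False \<longrightarrow> 2 \<le> i' \<and> Q (i'-1,k') = Bump False))
     \<or> ?P (i,k) = Cross \<and> (2 \<le> i \<longrightarrow> ?P (i-1,k) \<noteq> Bump False)"
    if ik: "1 \<le> i" "1 \<le> k" and nb: "?P (i,k) \<noteq> Bump False" for i k
  proof -
    consider (right) "C < k" | (col) "k = C" | (left) "k < C" by linarith
    then show ?thesis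
    proof cases
      case right
      have P: "?P (i',k) = Q (i',k-1)" if "1 \<le> i'" for i'
        using insert_pipe_right[of i' C k] that right by simp
      have "1 \<le> k - 1" using right C by simp
      moreover have "Q (i,k-1) = ?P (i,k)" "shift C (T i (k-1)) = ?T i k" "shift C (R i (k-1)) = ?R i k"
        "2 \<le> i \<and> ?P (i-1,k) = Bump False \<longrightarrow> 2 \<le> i \<and> Q (i-1,k-1) = Bump False"
        using P[of i] P[of "i-1"] ik right by (auto simp add: insert_top_def insert_right_def)
      ultimately show ?thesis using ik by (intro disjI1 exI[of _ i] exI[of _ "k-1"]) simp
    next
      case col
      have P: "?P (i',C) = (if i' < h (C-1) then Cross else Bump False)" if "1 \<le> i'" for i'
        using insert_pipe_col that C by blast
      have i: "i < h (C-1)" using P[of i] nb ik col by (cases "i < h (C-1)") auto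
      show ?thesis using P[of i] P[of "i-1"] ik col i by (intro disjI2) auto
    next
      case left
      note l = insert_pipe_left[OF path ik(2) left] and d = insertion_pathD[OF path ik(2) left]
      consider (above) "i < h k" | (cross) "h (k-1) = h k" "i = h k" | (below) "h (k-1) < i"
        using d nb l(4,5) by (metis linorder_not_less nat_less_le not_less_eq_eq)
      then show ?thesis
      proof cases
        case above
        have "Q (i,k) = ?P (i,k)" "shift C (T i k) = ?T i k" "shift C (R i k) = ?R i k"
          "2 \<le> i \<and> ?P (i-1,k) = Bump False \<longrightarrow> 2 \<le> i \<and> Q (i-1,k) = Bump False"
          using l(1)[of i] l(1)[of "i-1"] ik left above by (auto simp add: insert_top_def insert_right_def)
        with ik show ?thesis by (intro disjI1 exI[of _ i] exI[of _ k]) simp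
      next
        case cross
        then show ?thesis using l(1)[of "i-1"] l(3) d by (intro disjI2) auto
      next
        case below
        have b: "2 \<le> i - 1 \<and> Q (i-1-1,k) = Bump False" if "2 \<le> i" "?P (i-1,k) = Bump False"
        proof (cases "i - 1 = h (k-1)")
          case True
          then have "h (k-1) = Suc (h k)" "Q (h k, k) = Bump False" using l(3) that d by auto
          then show ?thesis using True d by simp
        next
          case False
          then have "h (k-1) < i - 1" using below by linarith
          then show ?thesis using l(2)[of "i-1"] that d by auto
        qed
        have i: "1 \<le> i - 1" "\<not> i \<le> h k" "\<not> i < h k" "i \<noteq> h k" "\<not> i \<le> h (k-1)" using below d by auto
        then have "Q (i-1,k) = ?P (i,k)" "shift C (T (i-1) k) = ?T i k" "shift C (R (i-1) k) = ?R i k"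
          using l(2)[of i] left below by (simp_all add: insert_top_def insert_right_def)
        with b i(1) ik show ?thesis by (intro disjI1 exI[of _ "i-1"] exI[of _ k]) simp
      qed
    qed
  qed
  \<comment> \<open>Left of \<open>C\<close> the path either adds a crossing directly below a
    crossing (or in row 1), or doubles an unmarked bump; both keep the shape "crossings, then
    unmarked bumps".\<close>
  have col: "(\<exists>r. \<forall>i\<ge>1. ?P (i,shift C C') = (if i \<le> r then Cross else Bump False)) \<longleftrightarrow>
     (\<exists>r. \<forall>i\<ge>1. Q (i,C') = (if i \<le> r then Cross else Bump False))" (is "?A \<longleftrightarrow> ?B")
  proof (cases "C \<le> C'")
    case True
    then have "?P (i,shift C C') = Q (i,C')" if "1 \<le> i" for i
      using insert_pipe_right[of i C "Suc C'"] that by (simp add: shift_def)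
    then show ?thesis by auto
  next
    case False
    then have left: "C' < C" and sh: "shift C C' = C'" by (auto simp: shift_def)
    note l = insert_pipe_left[OF path C' left] and d = insertion_pathD[OF path C' left]
    consider (cross) "h (C'-1) = h C'" "h C' = 1 \<or> Q (h C' - 1, C') \<noteq> Bump False"
      | (bump) "h (C'-1) = Suc (h C')" "Q (h C', C') = Bump False" using d by blast
    then show ?thesis
    proof cases
      case cross
      show ?thesis
      proof
        assume ?A
        then obtain r where r: "\<And>i. 1 \<le> i \<Longrightarrow> ?P (i,C') = (if i \<le> r then Cross else Bump False)" using sh by auto
        have hr: "h C' \<le> r" using r[OF d(1)] l(3)[OF cross(1)] by (auto split: if_splits)
        have "Q (i,C') = (if i \<le> r - 1 then Cross else Bump False)" if "1 \<le> i" for i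
        proof -
          have "i \<le> r - 1 \<longleftrightarrow> Suc i \<le> r" using hr d by linarith
          then show ?thesis
            using r[of i] r[of "Suc i"] l(1)[of i] l(2)[of "Suc i"] hr that cross(1) by (cases "i < h C'") auto
        qed
        then show ?B by blast
      next
        assume ?B
        then obtain r where r: "\<And>i. 1 \<le> i \<Longrightarrow> Q (i,C') = (if i \<le> r then Cross else Bump False)" by blast
        have hr: "h C' \<le> Suc r"
        proof (cases "h C' = 1")
          case False
          then show ?thesis using r[of "h C' - 1"] cross d by (auto split: if_splits)
        qed simp
        have "?P (i,C') = (if i \<le> Suc r then Cross else Bump False)" if "1 \<le> i" for i
        proof -
          consider "i < h C'" | "i = h C'" | "h C' < i" by linarith
          then show ?thesis
          proof cases
            case 3
            then have "1 \<le> i - 1" "i - 1 \<le> r \<longleftrightarrow> i \<le> Suc r" using d by auto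
            then show ?thesis using r[of "i-1"] l(2)[of i] 3 cross(1) by simp
          qed (use r[of i] l(1)[of i] l(3) hr that cross(1) in auto)
        qed
        then show ?A using sh by auto
      qed
    next
      case bump
      show ?thesis
      proof
        assume ?A
        then obtain r where r: "\<And>i. 1 \<le> i \<Longrightarrow> ?P (i,C') = (if i \<le> r then Cross else Bump False)" using sh by auto
        have hr: "r < h C'" using r[OF d(1)] l(4)[OF bump(1)] by (auto split: if_splits)
        have "Q (i,C') = (if i \<le> r then Cross else Bump False)" if "1 \<le> i" for i
        proof -
          consider "i < h C'" | "i = h C'" | "h C' < i" by linarith
          then show ?thesis
            by cases (use r[of i] r[of "Suc i"] l(1)[of i] l(2)[of "Suc i"] hr that bump in auto)
        qed
        then show ?B by blast
      next
        assume ?B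
        then obtain r where r: "\<And>i. 1 \<le> i \<Longrightarrow> Q (i,C') = (if i \<le> r then Cross else Bump False)" by blast
        have hr: "r < h C'" using r[OF d(1)] bump by (auto split: if_splits)
        have "?P (i,C') = (if i \<le> r then Cross else Bump False)" if "1 \<le> i" for i
        proof -
          consider "i < h C'" | "i = h C'" | "i = Suc (h C')" | "Suc (h C') < i" by linarith
          then show ?thesis
          proof cases
            case 4
            then have "1 \<le> i - 1" "\<not> i - 1 \<le> r" "\<not> i \<le> r" using hr by auto
            then show ?thesis using r[of "i-1"] l(2)[of i] 4 bump(1) by simp
          qed (use r[of i] l(1)[of i] l(4,5) hr that bump(1) in auto)
        qed
        then show ?A using sh by auto
      qed
    qed
  qed
  have tiles: "(\<forall>i k. 1 \<le> i \<and> 1 \<le> k \<and> (?T i k = shift C C' \<or> ?R i k = shift C C') \<longrightarrow>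
        ?P (i,k) \<noteq> Bump True \<and> (?P (i,k) = Cross \<and> 2 \<le> i \<longrightarrow> ?P (i-1,k) \<noteq> Bump False)) \<longleftrightarrow>
      (\<forall>i k. 1 \<le> i \<and> 1 \<le> k \<and> (T i k = C' \<or> R i k = C') \<longrightarrow>
        Q (i,k) \<noteq> Bump True \<and> (Q (i,k) = Cross \<and> 2 \<le> i \<longrightarrow> Q (i-1,k) \<noteq> Bump False))" (is "?A \<longleftrightarrow> ?B")
  proof
    assume A: ?A
    show ?B
    proof (intro allI impI)
      fix i k assume *: "1 \<le> i \<and> 1 \<le> k \<and> (T i k = C' \<or> R i k = C')"
      show "Q (i,k) \<noteq> Bump True \<and> (Q (i,k) = Cross \<and> 2 \<le> i \<longrightarrow> Q (i-1,k) \<noteq> Bump False)"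
      proof (cases "Q (i,k) = Bump False")
        case False
        then obtain i' k' where "1 \<le> i'" "1 \<le> k'" "?P (i',k') = Q (i,k)" "?T i' k' = shift C (T i k)"
          "?R i' k' = shift C (R i k)"
          "2 \<le> i \<and> Q (i-1,k) = Bump False \<longrightarrow> 2 \<le> i' \<and> ?P (i'-1,k') = Bump False"
          using M * by blast
        with A[rule_format, of i' k'] * show ?thesis by metis
      qed simp
    qed
  next
    assume B: ?B
    show ?A
    proof (intro allI impI)
      fix i k assume *: "1 \<le> i \<and> 1 \<le> k \<and> (?T i k = shift C C' \<or> ?R i k = shift C C')"
      show "?P (i,k) \<noteq> Bump True \<and> (?P (i,k) = Cross \<and> 2 \<le> i \<longrightarrow> ?P (i-1,k) \<noteq> Bump False)"
      proof (cases "?P (i,k) = Bump False")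
        case False
        from M'[OF _ _ this] * consider (old) i' k' where "1 \<le> i'" "1 \<le> k'" "Q (i',k') = ?P (i,k)"
          "shift C (T i' k') = ?T i k" "shift C (R i' k') = ?R i k"
          "2 \<le> i \<and> ?P (i-1,k) = Bump False \<longrightarrow> 2 \<le> i' \<and> Q (i'-1,k') = Bump False"
          | (new) "?P (i,k) = Cross" "2 \<le> i \<longrightarrow> ?P (i-1,k) \<noteq> Bump False" by blast
        then show ?thesis
        proof cases
          case old
          then have "T i' k' = C' \<or> R i' k' = C'" using * shift_eq_iff by metis
          with old B[rule_format, of i' k'] show ?thesis by metis
        qed simp
      qed simp
    qed
  qed
  show ?thesis unfolding removable_at_def col tiles ..
qed

lemma (in labelled_pd) removal_path_exists:
  assumes rem: "removable_at P T R C" and C: "1 \<le> C" "C \<le> N"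
  obtains h where "removal_path C h P" "\<And>c. c < C \<Longrightarrow> R (h c) c = C"
proof -
  obtain r where r: "\<And>i. 1 \<le> i \<Longrightarrow> P (i,C) = (if i \<le> r then Cross else Bump False)"
    using rem unfolding removable_at_def by blast
  have tile: "P (i,k) \<noteq> Bump True \<and> (P (i,k) = Cross \<and> 2 \<le> i \<longrightarrow> P (i-1,k) \<noteq> Bump False)"
    if "1 \<le> i" "1 \<le> k" "T i k = C \<or> R i k = C" for i k
    using rem that unfolding removable_at_def by blast
  have "T i C = C" if "1 \<le> i" "i \<le> Suc r" for i
    using that
  proof (induction i rule: dec_induct)
    case base
    then show ?case using labelling_top[OF lab] C by simp
  next
    case (step i)
    then show ?case using Cross_simps(2)[of i C] r[of i] C by simp
  qed
  then have "R (Suc r) (C-1) = C" using Bump_simps(3)[of "Suc r" C] r[of "Suc r"] C by simp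
  \<comment> \<open>\<open>g n\<close> is the row in which pipe \<open>C\<close> enters column C - 1
    - n, starting just below the leading crossings of its own column.\<close>
  define g where "g = rec_nat (Suc r) (\<lambda>n x. if P (x, C-1-n) = Cross then x else Suc x)"
  have g0: "g 0 = Suc r" and gS: "g (Suc n) = (if P (g n, C-1-n) = Cross then g n else Suc (g n))" for n
    by (simp_all add: g_def)
  \<comment> \<open>After turning down at an unmarked bump the pipe cannot cross the next tile, as
    the tile above would be an unmarked bump, and cannot meet a mark. So it turns left at
    once.\<close>
  have bump: "P (Suc i, k) = Bump False \<and> P (i,k) = Bump False \<and> R (Suc i) (k-1) = C"
    if "1 \<le> i" "1 \<le> k" "R i k = C" "P (i,k) \<noteq> Cross" for i k
  proof -
    have 1: "P (i,k) = Bump False" using tile[of i k] that by (cases "P (i,k)") auto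
    have "T (Suc i) k = C" using Bump_simps(2)[of i k] that by simp
    then have "P (Suc i,k) \<noteq> Bump True" "P (Suc i,k) \<noteq> Cross" using tile[of "Suc i" k] 1 that by auto
    then have "P (Suc i,k) = Bump False" by (cases "P (Suc i,k)") auto
    then show ?thesis using 1 Bump_simps(3)[of "Suc i" k] \<open>T (Suc i) k = C\<close> that by simp
  qed
  have inv: "1 \<le> g n \<and> R (g n) (C-1-n) = C" if "n < C" for n
    using that
  proof (induction n)
    case 0
    then show ?case using g0 \<open>R (Suc r) (C-1) = C\<close> by simp
  next
    case (Suc n)
    have e: "C - 1 - Suc n = C - 1 - n - 1" by simp
    have IH: "1 \<le> g n" "R (g n) (C-1-n) = C" "1 \<le> C-1-n" using Suc by auto
    show ?case unfolding gS e
      using Cross_simps(3)[OF IH(1,3)] bump[OF IH(1,3,2)] IH by auto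
  qed
  define h where "h = (\<lambda>c. g (C-1-c))"
  have R: "R (h c) c = C" "1 \<le> h c" if "c < C" for c using inv[of "C-1-c"] that by (auto simp: h_def)
  have "removal_path C h P"
    unfolding removal_path_def
  proof (intro conjI allI impI)
    fix c assume "c < C" then show "1 \<le> h c" by (rule R)
  next
    fix i :: nat assume "1 \<le> i"
    moreover have "h (C-1) = Suc r" by (simp add: h_def g0)
    ultimately show "P (i,C) = (if i < h (C-1) then Cross else Bump False)" using r[of i] by auto
  next
    fix c assume c: "1 \<le> c \<and> c < C"
    have "C-1-(c-1) = Suc (C-1-c)" "C-1-(C-1-c) = c" using c by auto
    then have hS: "h (c-1) = (if P (h c, c) = Cross then h c else Suc (h c))"
      using gS[of "C-1-c"] unfolding h_def by (simp only:)
    show "h (c-1) = h c \<and> P (h c, c) = Cross \<and> (h c = 1 \<or> P (h c - 1, c) \<noteq> Bump False) \<or>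
        h (c-1) = Suc (h c) \<and> P (h c, c) = Bump False \<and> P (Suc (h c), c) = Bump False"
    proof (cases "P (h c, c) = Cross")
      case True
      then show ?thesis using hS tile[of "h c" c] R[of c] c by auto
    next
      case False
      then show ?thesis using hS bump[of "h c" c] R[of c] c by auto
    qed
  qed
  then show ?thesis using R that by blast
qed

lemma phi1_eq_remove_pipe:
  assumes "C = col v j" and "\<And>r c. 1 \<le> c \<Longrightarrow> c < C \<Longrightarrow> visits P C (r, c, FromRight) \<longleftrightarrow> r = h c"
  shows "phi1 v j P = remove_pipe C h P"
proof (intro ext, clarify)
  fix i c
  show "phi1 v j P (i,c) = remove_pipe C h P (i,c)"
  proof (cases "1 \<le> c \<and> c < C")
    case True
    then have "(THE r. visits P C (r, c, FromRight)) = h c" using assms(2) by simp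
    then show ?thesis using True by (simp add: phi1_def remove_pipe_def Let_def assms(1)[symmetric])
  next
    case False
    then show ?thesis by (auto simp add: phi1_def remove_pipe_def Let_def assms(1)[symmetric])
  qed
qed

section \<open>The reduction of a single pipe\<close>

text \<open>Both directions use this setting: \<open>removable_decompose\<close> with the path read
  off a given pipe dream, \<open>phi1_surj\<close> with the greedy path.\<close>

locale insertion = labelled_pd m Q T R for m Q T R +
  fixes v :: "nat list" and j C :: nat and h :: "nat \<Rightarrow> nat"
  assumes v: "distinct v" and j: "j \<in> set v" and C: "C = col v j" and m: "length v = Suc m"
    and path: "insertion_path C h Q" and exit_row: "v ! (h 0 - 1) = j"
    and bound: "\<And>c. c < C \<Longrightarrow> h c + c \<le> Suc m"
begin

abbreviation "P \<equiv> insert_pipe C h Q"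
abbreviation "TP \<equiv> insert_top C h T R"
abbreviation "RP \<equiv> insert_right C h R"

lemma C_bounds: "1 \<le> C" "C \<le> Suc m"
  using col_spec(1,2)[OF v j] C m by auto

lemma h_pos: "c < C \<Longrightarrow> 1 \<le> h c"
  using path unfolding insertion_path_def by blast

lemma length_remove: "length (remove1 j v) = m"
  using j m by (simp add: length_remove1)

lemma labelled_insert: "labelled_pd (length v) P TP RP"
  using pd_insert_pipe[OF pd path C_bounds bound] labelling_insert_pipe[OF lab path C_bounds(1)] m
  by (simp add: labelled_pd_def)

lemma labelled_Q: "labelled_pd (length (remove1 j v)) Q T R"
  using labelled_pd_axioms length_remove by simp

lemma phi1_insert: "phi1 v j P = Q"
proof -
  interpret L: labelled_pd "length v" P TP RP by (rule labelled_insert)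
  have "visits P C (r, c, FromRight) \<longleftrightarrow> r = h c" if "1 \<le> c" "c < C" for r c
  proof (cases "1 \<le> r")
    case True
    then show ?thesis using L.visits_right[OF C_bounds(1) True that(1)] insert_right_eq_iff[OF that(2)] by simp
  next
    case False
    then show ?thesis using L.visits_pos[OF C_bounds(1)] h_pos[OF that(2)] by auto
  qed
  then have "phi1 v j P = remove_pipe C h P" by (rule phi1_eq_remove_pipe[OF C])
  also have "\<dots> = Q" by (rule remove_insert_pipe[OF path pd_zero[OF pd] C_bounds(1)])
  finally show ?thesis .
qed

lemma removable_insert:
  "removable v P j' \<longleftrightarrow> j' = j \<or> removable (remove1 j v) Q j'"
proof (cases "j' \<in> set v")
  case False
  then show ?thesis using j by (auto simp: removable_def v)
next
  case True
  note r = removable_iff[OF labelled_insert v True]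
  show ?thesis
  proof (cases "j' = j")
    case True
    then show ?thesis using r C removable_at_insert_pipe_self[OF path C_bounds(1)] by simp
  next
    case False
    have j': "j' \<in> set (remove1 j v)" "distinct (remove1 j v)" using v True False by auto
    have "removable (remove1 j v) Q j' \<longleftrightarrow> removable_at Q T R (col (remove1 j v) j')"
      by (rule removable_iff[OF labelled_Q j'(2,1)])
    moreover have "col v j' = shift C (col (remove1 j v) j')" using col_remove1[OF v j True False] C by simp
    moreover have "1 \<le> col (remove1 j v) j'" using col_spec(1)[OF j'(2,1)] .
    ultimately show ?thesis using r False removable_at_insert_pipe[OF path C_bounds(1)] by simp
  qed
qed

lemma MRPD_insert:
  "P \<in> MRPD v \<longleftrightarrow> Q \<in> MRPD (remove1 j v) \<and> (\<forall>c. 1 \<le> c \<and> c < C \<and> h (c-1) = h c \<longrightarrow> T (h c) c < C)"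
proof -
  interpret L: labelled_pd "length v" P TP RP by (rule labelled_insert)
  have h0: "1 \<le> h 0" "h 0 \<le> length v" using h_pos[of 0] bound[of 0] C_bounds m by auto
  have L': "labelled_pd (length v - 1) Q T R" using labelled_pd_axioms m by simp
  have "exit_labels v RP \<longleftrightarrow> exit_labels (remove1 j v) R"
    by (rule exit_labels_insert_pipe[OF v h0 exit_row C _ L']) (rule refl)
  then show ?thesis
    using MRPD_iff[OF L.lab v] MRPD_iff[OF lab distinct_remove1[OF v], of j] L.pd pd length_remove
      good_labels_insert_pipe[OF labelled_pd_axioms path C_bounds(1)] by auto
qed

end

lemma removable_decompose:
  assumes v: "distinct v" and P: "P \<in> MRPD v" and rem: "removable v P j"
  obtains h T R where "insertion (length v - 1) (phi1 v j P) T R v j (col v j) h"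
    "P = insert_pipe (col v j) h (phi1 v j P)"
proof -
  define C where "C = col v j"
  define m where "m = length v - 1"
  have j: "j \<in> set v" using rem by (simp add: removable_def)
  then have m: "length v = Suc m" unfolding m_def by (cases v) auto
  have C: "1 \<le> C" "C \<le> Suc m" using col_spec(1,2)[OF v j] m by (auto simp: C_def)
  have pd: "is_pipe_dream (length v) P" using P by (simp add: MRPD_def reduced_def)
  obtain T R where lab: "labelling P T R" using ex_labelling[OF pd] .
  interpret labelled_pd "length v" P T R using pd lab by (rule labelled_pd.intro)
  have "removable_at P T R C" using removable_iff[OF labelled_pd_axioms v j] rem C_def by simp
  then obtain h where path: "removal_path C h P" and R: "\<And>c. c < C \<Longrightarrow> R (h c) c = C"
    using removal_path_exists C m by metis
  have hpos: "1 \<le> h c" if "c < C" for c using path that unfolding removal_path_def by blast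
  \<comment> \<open>Outside the staircase the label of an edge is the sum of its coordinates, which
    would make \<open>C\<close> exceed the length of \<open>v\<close>.\<close>
  have bound: "h c + c \<le> Suc m" if "c < C" for c
    using R_outside[OF hpos[OF that], of c] R[OF that] C m by (cases "length v < h c + c") auto
  define Q where "Q = remove_pipe C h P"
  have ins: "insert_pipe C h Q = P" "insertion_path C h Q"
    using insert_remove_pipe[OF path pd_zero[OF pd] C(1)] by (auto simp: Q_def)
  have pdQ: "is_pipe_dream m Q" unfolding Q_def using pd_remove_pipe[OF _ path C bound] pd m by simp
  obtain TQ RQ where labQ: "labelling Q TQ RQ" using ex_labelling[OF pdQ] .
  have "exit_labels v R" using MRPD_iff[OF lab v] P by simp
  then have "v ! (h 0 - 1) = j"
    using hpos[of 0] bound[of 0] R[of 0] C m col_spec(3)[OF v j] unfolding exit_labels_def C_def by simp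
  then have I: "insertion m Q TQ RQ v j C h"
    using pdQ labQ v j m ins(2) bound
    by (simp add: insertion_def insertion_axioms_def labelled_pd_def C_def)
  then have "phi1 v j P = Q" using insertion.phi1_insert ins(1) by metis
  then show ?thesis using that[of TQ RQ h] I ins(1) unfolding C_def m_def by simp
qed

lemma insertion_path_unique:
  assumes "insertion_path C h Q" "insertion_path C h' Q" "h 0 = h' 0" "c < C"
  shows "h c = h' c"
  using assms(4)
proof (induction c)
  case 0
  then show ?case using assms(3) by simp
next
  case (Suc c)
  \<comment> \<open>Here u is the row on the left, x and y are the candidates for the next row, and
    A says that a tile of the column is not an unmarked bump. Both alternatives query A at u -
    1.\<close>
  have det: "x = y" if "1 \<le> x" "1 \<le> y" "u = x \<and> (x = 1 \<or> A (x - 1)) \<or> u = Suc x \<and> \<not> A x"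
      "u = y \<and> (y = 1 \<or> A (y - 1)) \<or> u = Suc y \<and> \<not> A y" for x y u :: nat and A
    using that by (elim disjE conjE) auto
  have "1 \<le> Suc c" by simp
  note d = insertion_pathD[OF assms(1) this Suc.prems] insertion_pathD[OF assms(2) this Suc.prems]
  show ?case
    by (rule det[of _ _ "h c" "\<lambda>i. Q (i, Suc c) \<noteq> Bump False"]) (use d Suc in simp_all)
qed

lemma inj_on_phi1:
  assumes v: "distinct v"
  shows "inj_on (phi1 v j) {P \<in> MRPD v. removable v P j}"
proof (rule inj_onI, clarify)
  fix P P' assume P: "P \<in> MRPD v" "removable v P j" and P': "P' \<in> MRPD v" "removable v P' j"
    and eq: "phi1 v j P = phi1 v j P'"
  obtain h T R where I: "insertion (length v - 1) (phi1 v j P) T R v j (col v j) h"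
    "P = insert_pipe (col v j) h (phi1 v j P)" by (rule removable_decompose[OF v P])
  obtain h' T' R' where I': "insertion (length v - 1) (phi1 v j P) T' R' v j (col v j) h'"
    "P' = insert_pipe (col v j) h' (phi1 v j P)" unfolding eq by (rule removable_decompose[OF v P'])
  interpret A: insertion "length v - 1" "phi1 v j P" T R v j "col v j" h by (rule I)
  interpret B: insertion "length v - 1" "phi1 v j P" T' R' v j "col v j" h' by (rule I')
  have "h 0 - 1 < length v" "h' 0 - 1 < length v"
    using A.bound[of 0] B.bound[of 0] A.C_bounds A.h_pos[of 0] B.h_pos[of 0] A.m by auto
  \<comment> \<open>The exit row is the position of \<open>j\<close> in \<open>v\<close>, so both
    paths start in the same row on the left.\<close>
  then have "h 0 - 1 = h' 0 - 1" using A.exit_row B.exit_row v nth_eq_iff_index_eq by metis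
  then have "h 0 = h' 0" using A.h_pos[of 0] B.h_pos[of 0] A.C_bounds by auto
  then have "h c = h' c" if "c < col v j" for c
    using insertion_path_unique[OF A.path B.path _ that] by simp
  then have "insert_pipe (col v j) h = insert_pipe (col v j) h'"
    using A.C_bounds(1) by (intro ext) (auto simp: insert_pipe_def)
  then show "P = P'" using I(2) I'(2) by simp
qed

text \<open>The second claim drives the inductions over lists of pipes: one reduction takes exactly
  \<open>j\<close> out of the set of removable pipes.\<close>

lemma phi1_MRPD:
  assumes v: "distinct v" and P: "P \<in> MRPD v" and rem: "removable v P j"
  shows "phi1 v j P \<in> MRPD (remove1 j v)"
    and "removable (remove1 j v) (phi1 v j P) j' \<longleftrightarrow> removable v P j' \<and> j' \<noteq> j"
proof -
  obtain h T R where I: "insertion (length v - 1) (phi1 v j P) T R v j (col v j) h"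
    "P = insert_pipe (col v j) h (phi1 v j P)" by (rule removable_decompose[OF v P rem])
  interpret insertion "length v - 1" "phi1 v j P" T R v j "col v j" h by (rule I)
  show "phi1 v j P \<in> MRPD (remove1 j v)" using MRPD_insert I(2) P by simp
  have "\<not> removable (remove1 j v) (phi1 v j P) j" using v by (simp add: removable_def)
  then show "removable (remove1 j v) (phi1 v j P) j' \<longleftrightarrow> removable v P j' \<and> j' \<noteq> j"
    using removable_insert[of j'] I(2) by auto
qed

text \<open>The guard \<open>2 \<le> x\<close> matters: row 0 counts as unmarked bumps, and without
  it the path could leave the grid at the top.\<close>

primrec greedy_path :: "pd \<Rightarrow> nat \<Rightarrow> nat \<Rightarrow> nat" where
  "greedy_path Q p 0 = p"
| "greedy_path Q p (Suc c) = (let x = greedy_path Q p c in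
     if 2 \<le> x \<and> Q (x - 1, Suc c) = Bump False then x - 1 else x)"

lemma insertion_path_greedy:
  assumes "1 \<le> p"
  shows "insertion_path C (greedy_path Q p) Q"
proof -
  have pos: "1 \<le> greedy_path Q p c" for c
    by (induction c) (use assms in \<open>auto simp: Let_def\<close>)
  show ?thesis
    unfolding insertion_path_def
  proof (intro conjI allI impI)
    fix c assume "1 \<le> c \<and> c < C"
    then obtain b where c: "c = Suc b" by (cases c) auto
    show "greedy_path Q p (c-1) = greedy_path Q p c \<and> (greedy_path Q p c = 1 \<or> Q (greedy_path Q p c - 1, c) \<noteq> Bump False) \<or>
        greedy_path Q p (c-1) = Suc (greedy_path Q p c) \<and> Q (greedy_path Q p c, c) = Bump False"
      using pos[of b] by (auto simp: c Let_def)
  qed (rule pos)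
qed

text \<open>When the path touches the outer boundary, the tile above it lies on the outer diagonal
  of \<open>Q\<close>. It is neither a crossing nor marked, since its right label m + 1 exceeds its
  top label; so the path must rise in that column.\<close>

lemma greedy_path_bound:
  assumes L: "labelled_pd m Q T R" and good: "good_labels Q T R" and p: "1 \<le> p" "p \<le> Suc m"
  shows "c \<le> m \<Longrightarrow> greedy_path Q p c + c \<le> Suc m"
proof (induction c)
  case 0
  then show ?case using p by simp
next
  case (Suc c)
  interpret labelled_pd m Q T R by (rule L)
  define x where "x = greedy_path Q p c"
  have IH: "x + c \<le> Suc m" using Suc by (simp add: x_def)
  have "Q (x - 1, Suc c) = Bump False" if "x + c = Suc m"
  proof -
    have i: "1 \<le> x - 1" "x - 1 + Suc c = Suc m" using that Suc.prems by auto
    have "Q (x - 1, Suc c) \<noteq> Cross" using pd_not_Cross[OF pd] i by auto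
    moreover have "T (x-1) (Suc c) \<le> m" "R (x-1) (Suc c) = Suc m"
      using T_inside[OF i(1)] R_outside[OF i(1)] i by auto
    then have "Q (x - 1, Suc c) \<noteq> Bump True" using good i unfolding good_labels_def by fastforce
    ultimately show ?thesis by (cases "Q (x - 1, Suc c)") auto
  qed
  then show ?case using IH Suc.prems by (cases "x + c = Suc m") (auto simp: x_def[symmetric] Let_def)
qed

section \<open>The pattern 1423\<close>

lemma (in labelled_pd) label_down:
  assumes "1 \<le> k" "i \<le> r" "1 \<le> i" "T i k = e"
  shows "T r k = e \<or> (\<exists>i'. i \<le> i' \<and> i' < r \<and> T i' k = e \<and> R i' (k-1) = e)"
  using assms(2-4)
proof (induction i rule: inc_induct)
  case base
  then show ?case by simp
next
  case (step i)
  show ?case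
  proof (cases "P (i,k) = Cross")
    case True
    then have "T (Suc i) k = e" using Cross_simps(2) step.prems assms(1) by simp
    with step.IH show ?thesis using Suc_leD by fastforce
  next
    case False
    then have "R i (k-1) = e" using Bump_simps(3) step.prems assms(1) by simp
    then show ?thesis using step.hyps step.prems by (intro disjI2 exI[of _ i]) simp
  qed
qed

lemma (in labelled_pd) label_down_exit:
  assumes "1 \<le> k" "1 \<le> i" "T i k = e"
  obtains i' where "i \<le> i'" "R i' (k-1) = e"
proof -
  \<comment> \<open>A row far enough down to lie outside the staircase, where a bump forces the pipe
    out of the column.\<close>
  let ?r = "i + N + 1"
  have "P (?r, k) \<noteq> Cross" using pd_not_Cross[OF pd] assms by auto
  then have "R ?r (k-1) = T ?r k" using Bump_simps(3)[of ?r k] assms by simp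
  then have "\<exists>i'\<ge>i. R i' (k-1) = e"
  proof (cases "T ?r k = e")
    case False
    then show ?thesis using label_down[OF assms(1) _ assms(2,3), of ?r] by auto
  qed (auto intro!: exI[of _ ?r])
  then show ?thesis using that by blast
qed

lemma good_labelsD:
  assumes "good_labels P T R" "1 \<le> i" "1 \<le> k"
  shows "P (i,k) = Cross \<Longrightarrow> T i k < R i k" "P (i,k) = Bump True \<Longrightarrow> R i k < T i k"
  using assms unfolding good_labels_def by blast+

lemma sort_nth_less:
  fixes v :: "nat list"
  assumes "distinct v" "1 \<le> a" "a < b" "b \<le> length v"
  shows "sort v ! (a - 1) < sort v ! (b - 1)"
proof -
  have "a - 1 < b - 1" "b - 1 < length (sort v)" using assms by auto
  then show ?thesis
    using sorted_wrt_nth_less[of "(<)" "sort v" "a-1" "b-1"] assms(1) by (simp add: strict_sorted_iff)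
qed

context insertion
begin

text \<open>The failure of the extra condition in \<open>MRPD_insert\<close>. Labels of
  \<open>Q\<close> from \<open>C\<close> on become larger than \<open>C\<close> after
  insertion.\<close>

definition bad :: "nat \<Rightarrow> bool" where
  "bad c \<longleftrightarrow> 1 \<le> c \<and> c < C \<and> h (c-1) = h c \<and> C \<le> T (h c) c"

lemma path_step:
  assumes "1 \<le> k" "k < C"
  shows "h k \<le> h (k-1)" "h (k-1) = h k \<or> h (k-1) = Suc (h k) \<and> Q (h k, k) = Bump False"
  using insertion_pathD[OF path assms] by auto

text \<open>In the coordinates of \<open>Q\<close>, an edge in row i of the border k lies below the
  path iff \<open>h k \<le> i\<close>, because insertion pushes it to row i + 1. A crossing in row
  \<open>h k\<close> cannot be split, so the path stays level there.\<close>

lemma large_below: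
  assumes k: "1 \<le> k" "k < C" and i: "h k \<le> i" "R i k = a"
  obtains i' where "h (k-1) \<le> i'" "R i' (k-1) = a"
proof (cases "Q (i,k) = Cross")
  case True
  then have "h (k-1) \<le> i" using path_step[OF k] i(1) by (cases "i = h k") auto
  moreover have "R i (k-1) = a" using Cross_simps(3)[of i k] True i h_pos[OF k(2)] k by simp
  ultimately show ?thesis using that by blast
next
  case False
  then have "T (Suc i) k = a" using Bump_simps(2)[of i k] i h_pos[OF k(2)] k by simp
  then obtain i' where i': "Suc i \<le> i'" "R i' (k-1) = a" using label_down_exit[OF k(1), of "Suc i"] by auto
  have "h (k-1) \<le> Suc i" using path_step[OF k] i(1) by auto
  then have "h (k-1) \<le> i'" using i'(1) by linarith
  then show ?thesis using that i'(2) by blast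
qed

text \<open>If b is crossed by a smaller pipe in column k, then that pipe is at most one of the two
  small pipes d and k that enter column k above b, so a small pipe remains above b.\<close>

lemma small_above_step:
  assumes k: "1 \<le> k" "k < C" and nb: "\<not> bad k"
    and i: "1 \<le> i2" "i2 < i" "i < h k" "R i2 k < C" "R i k = b" "C \<le> b"
  obtains i2' i' where "1 \<le> i2'" "i2' < i'" "i' < h (k-1)" "R i2' (k-1) < C" "R i' (k-1) = b"
proof -
  have top: "T 1 k = k" using labelling_top[OF lab k(1)] .
  have leave: "\<exists>i2'. 1 \<le> i2' \<and> i2' < r \<and> R i2' (k-1) = e" if "T s k = e" "1 \<le> s" "s \<le> r" "T r k \<noteq> e" for s r e
    using label_down[OF k(1) that(3,2,1)] that(2,4) order_trans by blast
  show ?thesis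
  proof (cases "Q (i,k) = Cross")
    case True
    have Ri: "R i (k-1) = b" "i < h (k-1)"
      using Cross_simps(3)[of i k] True i k path_step(1)[OF k] by auto
    have "\<exists>i2'. 1 \<le> i2' \<and> i2' < i \<and> R i2' (k-1) < C"
    \<comment> \<open>Pipe k entered at the top of column k. Either it has left the column above row
      i, or it is the pipe crossed by b; then the other small pipe \<open>R i2 k\<close> must leave
      above row i.\<close>
    proof (cases "T i k = k")
      case False
      then show ?thesis using leave[OF top, of i] i k by fastforce
    next
      case Tk: True
      show ?thesis
      proof (cases "Q (i2,k) = Cross")
        case True
        then show ?thesis using Cross_simps(3)[of i2 k] i k by fastforce
      next
        case False
        then have "T (Suc i2) k = R i2 k" using Bump_simps(2)[of i2 k] i k by simp
        moreover have "T i k \<noteq> R i2 k" using R_gt[of i2 k] i Tk by simp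
        ultimately show ?thesis using leave[of "Suc i2" "R i2 k" i] i by fastforce
      qed
    qed
    then show ?thesis using that Ri by blast
  next
    case False
    then have Tb: "T (Suc i) k = b" using Bump_simps(2)[of i k] i k by simp
    have "\<exists>i'. Suc i \<le> i' \<and> i' < h (k-1) \<and> R i' (k-1) = b \<and> T i' k = b"
    proof (cases "T (h k) k = b")
      case False
      then show ?thesis using label_down[OF k(1) _ _ Tb, of "h k"] i path_step(1)[OF k] by fastforce
    next
      case True
      \<comment> \<open>A level path would cross b here and make column k bad. So the path splits
        the bump, and b leaves to the left on its upper side.\<close>
      then have "h (k-1) \<noteq> h k" using nb k i by (auto simp: bad_def)
      then have 1: "h (k-1) = Suc (h k)" "Q (h k,k) = Bump False" using path_step[OF k] by auto
      then have "R (h k) (k-1) = b" using Bump_simps(3)[of "h k" k] True h_pos[OF k(2)] k by simp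
      then show ?thesis using 1 i True by (intro exI[of _ "h k"]) simp
    qed
    then obtain i' where i': "Suc i \<le> i'" "i' < h (k-1)" "R i' (k-1) = b" "T i' k = b" by blast
    then obtain i2' where "1 \<le> i2'" "i2' < i'" "R i2' (k-1) = k"
      using leave[OF top, of i'] i k by auto
    then show ?thesis using that[of i2' i'] i' k by simp
  qed
qed

lemma not_bad:
  assumes good: "good_labels Q T R" and exit: "exit_labels v RP" and av: "avoids_1423 v"
  shows "\<not> bad c"
proof
  assume "bad c"
  then obtain c where bad: "bad c" and least: "\<And>k. k < c \<Longrightarrow> \<not> bad k"
    using exists_least_iff[of bad] by blast
  have c: "1 \<le> c" "c < C" "h (c-1) = h c" and aC: "C \<le> T (h c) c" using bad by (auto simp: bad_def)
  define a where "a = T (h c) c"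
  have top: "T 1 c = c" using labelling_top[OF lab c(1)] .
  have "h c \<noteq> 1" using top aC c by auto
  then obtain g where g: "h c = Suc g" "1 \<le> g" using h_pos[OF c(2)] by (cases "h c") auto
  \<comment> \<open>The path is level in column c, so the tile above it is a crossing or a marked
    bump; both force an order of the two labels.\<close>
  have nb: "Q (g, c) \<noteq> Bump False" using insertion_pathD(2)[OF path c(1,2)] c(3) g by auto
  \<comment> \<open>b is the partner of a at that tile: it comes from the right at a crossing and
    from the top at a marked bump. It is larger than a and leaves to the left; the top label, being
    a or b, is at least \<open>C\<close>.\<close>
  have "\<exists>b. R g (c-1) = b \<and> a < b \<and> C \<le> T g c"
  proof (cases "Q (g,c)")
    case Cross
    then have "T g c = a" "R g (c-1) = R g c" using Cross_simps(2,3)[of g c] g c by (auto simp: a_def)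
    then show ?thesis using good_labelsD(1)[OF good g(2) c(1) Cross] aC unfolding a_def by auto
  next
    case (Bump x)
    then have "R g c = a" "R g (c-1) = T g c" using Bump_simps(2,3)[of g c] g c by (auto simp: a_def)
    moreover have "R g c < T g c" using good_labelsD(2)[OF good g(2) c(1)] Bump nb by (cases x) auto
    ultimately show ?thesis using aC unfolding a_def by auto
  qed
  then obtain b where b: "R g (c-1) = b" "a < b" "C \<le> T g c" by blast
  have Cb: "C \<le> b" using b aC by (simp add: a_def)
  \<comment> \<open>The small pipe is c itself: it entered at the top of column c, and the large
    label on top of tile (g,c) shows that it has left above row g.\<close>
  have start: "\<exists>i2 i i3. 1 \<le> i2 \<and> i2 < i \<and> i < h (c-1) \<and> R i2 (c-1) < C \<and> R i (c-1) = b \<and> h (c-1) \<le> i3 \<and> R i3 (c-1) = a"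
  proof -
    have "T g c \<noteq> c" using b(3) c(2) by simp
    then obtain i2 where "1 \<le> i2" "i2 < g" "R i2 (c-1) = c" using label_down[OF c(1) g(2) _ top] by auto
    moreover obtain i3 where "h c \<le> i3" "R i3 (c-1) = a"
      using label_down_exit[OF c(1) h_pos[OF c(2)] a_def[symmetric]] .
    ultimately show ?thesis using b(1) c(2,3) g(1)
      by (intro exI[of _ i2] exI[of _ g] exI[of _ i3]) simp
  qed
  \<comment> \<open>The configuration is carried from the border c - 1 to the left boundary; the
    columns passed are not bad, as c is the least bad one.\<close>
  have "\<exists>i2 i i3. 1 \<le> i2 \<and> i2 < i \<and> i < h 0 \<and> R i2 0 < C \<and> R i 0 = b \<and> h 0 \<le> i3 \<and> R i3 0 = a"
    using le0[of "c-1"]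
  proof (induction rule: inc_induct)
    case base
    then show ?case by (rule start)
  next
    case (step n)
    then obtain i2 i i3 where i: "1 \<le> i2" "i2 < i" "i < h (Suc n)" "R i2 (Suc n) < C" "R i (Suc n) = b"
      "h (Suc n) \<le> i3" "R i3 (Suc n) = a" by blast
    have k: "1 \<le> Suc n" "Suc n < C" "\<not> bad (Suc n)" using step.hyps c least[of "Suc n"] by auto
    obtain i2' i' where "1 \<le> i2'" "i2' < i'" "i' < h n" "R i2' n < C" "R i' n = b"
      using small_above_step[OF k i(1-5) Cb] by auto
    moreover obtain i3' where "h n \<le> i3'" "R i3' n = a"
      using large_below[OF k(1,2) i(6,7)] by auto
    ultimately show ?case by blast
  qed
  then obtain i2 i i3 where i: "1 \<le> i2" "i2 < i" "i < h 0" "R i2 0 < C" "R i 0 = b" "h 0 \<le> i3" "R i3 0 = a"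
    by blast
  have h0: "h 0 \<le> Suc m" using bound[of 0] C_bounds by simp
  have "a \<le> m" using T_inside[of "h c" c] bound[OF c(2)] h_pos[OF c(2)] c(1) by (simp add: a_def)
  then have i3m: "i3 \<le> m" using R_outside[of i3 0] i by (cases "m < i3") auto
  have "b \<le> m" using R_inside[of i 0] i h0 by simp
  have C0: "\<not> C \<le> 0" using C_bounds by simp
  \<comment> \<open>Rows above \<open>h 0\<close> stay in place, row i3 becomes row i3 + 1, and
    labels from \<open>C\<close> on increase by one.\<close>
  have RP: "RP i2 0 = R i2 0" "RP i 0 = Suc b" "RP (h 0) 0 = C" "RP (Suc i3) 0 = Suc a"
    using i C0 Cb aC by (auto simp: insert_right_def shift_def a_def)
  have val: "v ! (x - 1) = sort v ! (RP x 0 - 1)" if "1 \<le> x" "x \<le> Suc m" for x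
    using exit that m unfolding exit_labels_def by simp
  have "1 \<le> R i2 0" using R_gt[of i2 0] i by simp
  then have 1: "v ! (i2 - 1) < v ! (h 0 - 1)"
    using val[of i2] val[of "h 0"] RP i h0 C_bounds sort_nth_less[OF v, of "R i2 0" C] m by simp
  have 2: "v ! (h 0 - 1) < v ! i3"
    using val[of "Suc i3"] val[of "h 0"] RP i h0 i3m C_bounds sort_nth_less[OF v, of C "Suc a"] m \<open>a \<le> m\<close> aC
    by (simp add: a_def)
  have 3: "v ! i3 < v ! (i - 1)"
    using val[of "Suc i3"] val[of i] RP i h0 i3m sort_nth_less[OF v, of "Suc a" "Suc b"] m b(2) \<open>b \<le> m\<close> by simp
  \<comment> \<open>Positions in \<open>v\<close> are counted from 0, so row i3 + 1 is position i3.
    The four values have the relative order 1, 4, 2, 3.\<close>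
  have "i2 - 1 < i - 1" "i - 1 < h 0 - 1" "h 0 - 1 < i3" "i3 < length v" using i i3m m by auto
  with 1 2 3 av show False unfolding avoids_1423_def by blast
qed

lemma insert_in_MRPD:
  assumes Q: "Q \<in> MRPD (remove1 j v)" and av: "avoids_1423 v"
  shows "P \<in> MRPD v"
proof -
  interpret L: labelled_pd "length v" P TP RP by (rule labelled_insert)
  have h0: "1 \<le> h 0" "h 0 \<le> length v" using h_pos[of 0] bound[of 0] C_bounds m by auto
  have L': "labelled_pd (length v - 1) Q T R" using labelled_pd_axioms m by simp
  have "good_labels Q T R" "exit_labels (remove1 j v) R"
    using MRPD_iff[OF lab distinct_remove1[OF v], of j] Q by auto
  moreover have "exit_labels v RP \<longleftrightarrow> exit_labels (remove1 j v) R"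
    by (rule exit_labels_insert_pipe[OF v h0 exit_row C _ L']) (rule refl)
  ultimately have "\<not> bad c" for c using not_bad av by blast
  then show ?thesis using MRPD_insert Q by (auto simp: bad_def not_le)
qed

end

lemma phi1_surj:
  assumes v: "distinct v" and j: "j \<in> set v" and av: "avoids_1423 v" and Q: "Q \<in> MRPD (remove1 j v)"
  obtains P where "P \<in> MRPD v" "removable v P j" "phi1 v j P = Q"
proof -
  obtain l where l: "l < length v" "v ! l = j" using j by (auto simp: in_set_conv_nth)
  obtain m where m: "length v = Suc m" using l by (cases "length v") auto
  have len: "length (remove1 j v) = m" using j m by (simp add: length_remove1)
  have pd: "is_pipe_dream m Q" using Q unfolding MRPD_def reduced_def mem_Collect_eq len by blast
  obtain T R where lab: "labelling Q T R" using ex_labelling[OF pd] .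
  have L: "labelled_pd m Q T R" using pd lab by (rule labelled_pd.intro)
  have good: "good_labels Q T R" using MRPD_iff[OF lab distinct_remove1[OF v], of j] Q by blast
  \<comment> \<open>Position l of the word is row l + 1.\<close>
  define h where "h = greedy_path Q (Suc l)"
  have path: "insertion_path (col v j) h Q" unfolding h_def by (rule insertion_path_greedy) simp
  have bound: "h c + c \<le> Suc m" if "c < col v j" for c
  proof -
    have "c \<le> m" "Suc l \<le> Suc m" using that col_spec(2)[OF v j] l(1) m by linarith+
    then show ?thesis unfolding h_def using greedy_path_bound[OF L good, of "Suc l" c] by simp
  qed
  have exit: "v ! (h 0 - 1) = j" using l(2) by (simp add: h_def)
  interpret insertion m Q T R v j "col v j" h
    by (intro insertion.intro insertion_axioms.intro L v j refl m path exit bound)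
  show ?thesis using that insert_in_MRPD[OF Q av] removable_insert phi1_insert by blast
qed

section \<open>The reduction map\<close>

lemma avoids_1423_remove1:
  assumes "avoids_1423 v" "distinct v"
  shows "avoids_1423 (remove1 j v)"
proof (cases "j \<in> set v")
  case True
  then obtain p where p: "p < length v" "v ! p = j" unfolding in_set_conv_nth by blast
  note nth = remove1_nth[OF assms(2) p]
  have len: "length (remove1 j v) = length v - 1" using True by (simp add: length_remove1)
  have len': "shift p i < length v" if "i < length v - 1" for i using that by (auto simp: shift_def)
  show ?thesis
    unfolding avoids_1423_def
  proof (intro notI, elim exE conjE)
    fix a b c d
    assume *: "a < b" "b < c" "c < d" "d < length (remove1 j v)" "remove1 j v ! a < remove1 j v ! c"
      "remove1 j v ! c < remove1 j v ! d" "remove1 j v ! d < remove1 j v ! b"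
    have "a < length v - 1" "b < length v - 1" "c < length v - 1" "d < length v - 1" using * len by auto
    note n = this[THEN nth] and l = this[THEN len']
    have "shift p a < shift p b" "shift p b < shift p c" "shift p c < shift p d"
      using * by (simp_all add: shift_less_iff)
    then show False using assms(1) l(4) *(5-7) unfolding n avoids_1423_def by blast
  qed
next
  case False
  then show ?thesis using assms by (simp add: remove1_idem)
qed

abbreviation reduce_all :: "nat list \<Rightarrow> nat list \<Rightarrow> pd \<Rightarrow> nat list \<times> pd" where
  "reduce_all js v P \<equiv> foldl (\<lambda>(v, Q) j. (remove1 j v, phi1 v j Q)) (v, P) js"

lemma filter_remove1:
  "distinct v \<Longrightarrow> filter (\<lambda>x. x \<notin> J) (remove1 j v) = filter (\<lambda>x. x \<notin> insert j J) v"
  by (induction v) (auto intro!: filter_cong)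

text \<open>By \<open>phi1_MRPD\<close> the later entries of \<open>js\<close> are still removable
  when their turn comes, and no new removable pipe appears.\<close>

lemma reduce_all_MRPD:
  assumes "distinct v" "distinct js" "P \<in> MRPD v" "\<forall>j\<in>set js. removable v P j"
  shows "\<exists>Q. reduce_all js v P = (filter (\<lambda>x. x \<notin> set js) v, Q) \<and> Q \<in> MRPD (filter (\<lambda>x. x \<notin> set js) v) \<and>
     (\<forall>j. removable (filter (\<lambda>x. x \<notin> set js) v) Q j \<longleftrightarrow> removable v P j \<and> j \<notin> set js)"
  using assms
proof (induction js arbitrary: v P)
  case Nil
  then show ?case by simp
next
  case (Cons j js)
  have rem: "removable v P j" using Cons.prems by simp
  note p = phi1_MRPD[OF Cons.prems(1,3) rem]
  have "\<exists>Q. reduce_all js (remove1 j v) (phi1 v j P) = (filter (\<lambda>x. x \<notin> set js) (remove1 j v), Q) \<and>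
     Q \<in> MRPD (filter (\<lambda>x. x \<notin> set js) (remove1 j v)) \<and>
     (\<forall>j'. removable (filter (\<lambda>x. x \<notin> set js) (remove1 j v)) Q j' \<longleftrightarrow>
        removable (remove1 j v) (phi1 v j P) j' \<and> j' \<notin> set js)"
    by (rule Cons.IH) (use Cons.prems p in auto)
  then show ?case unfolding filter_remove1[OF Cons.prems(1)] p(2) by auto
qed

lemma reduce_all_inj:
  assumes "distinct v" "distinct js" "P \<in> MRPD v" "\<forall>j\<in>set js. removable v P j"
    "P' \<in> MRPD v" "\<forall>j\<in>set js. removable v P' j" "reduce_all js v P = reduce_all js v P'"
  shows "P = P'"
  using assms
proof (induction js arbitrary: v P P')
  case Nil
  then show ?case by simp
next
  case (Cons j js)
  have rem: "removable v P j" "removable v P' j" using Cons.prems by auto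
  note p = phi1_MRPD[OF Cons.prems(1,3) rem(1)] and p' = phi1_MRPD[OF Cons.prems(1,5) rem(2)]
  have "phi1 v j P = phi1 v j P'"
    by (rule Cons.IH[of "remove1 j v"]) (use Cons.prems p p' in auto)
  then show ?case using inj_on_phi1[OF Cons.prems(1), of j] rem Cons.prems(3,5) by (auto dest: inj_onD)
qed

text \<open>Pipes are inserted in the reverse order of their deletion. Each insertion uses
  \<open>phi1_surj\<close> for its own intermediate word, which inherits pattern avoidance from
  \<open>w\<close>.\<close>

lemma reduce_all_surj:
  assumes "distinct v" "avoids_1423 v" "distinct js" "set js \<subseteq> set v" "Q \<in> MRPD (filter (\<lambda>x. x \<notin> set js) v)"
  shows "\<exists>P\<in>MRPD v. (\<forall>j\<in>set js. removable v P j) \<and> reduce_all js v P = (filter (\<lambda>x. x \<notin> set js) v, Q)"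
  using assms
proof (induction js arbitrary: v)
  case Nil
  then show ?case by auto
next
  case (Cons j js)
  have j: "j \<in> set v" using Cons.prems by simp
  note f = filter_remove1[OF Cons.prems(1), of "set js" j]
  have "\<exists>P\<in>MRPD (remove1 j v). (\<forall>j'\<in>set js. removable (remove1 j v) P j') \<and>
      reduce_all js (remove1 j v) P = (filter (\<lambda>x. x \<notin> set js) (remove1 j v), Q)"
    by (rule Cons.IH) (use Cons.prems avoids_1423_remove1 f in auto)
  then obtain P' where P': "P' \<in> MRPD (remove1 j v)" "\<forall>j'\<in>set js. removable (remove1 j v) P' j'"
    "reduce_all js (remove1 j v) P' = (filter (\<lambda>x. x \<notin> set js) (remove1 j v), Q)" by blast
  obtain P where P: "P \<in> MRPD v" "removable v P j" "phi1 v j P = P'"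
    using phi1_surj[OF Cons.prems(1) j Cons.prems(2) P'(1)] .
  have "\<forall>j'\<in>set js. removable v P j'" using P'(2) phi1_MRPD(2)[OF Cons.prems(1) P(1,2)] P(3) by blast
  then show ?case using P P'(3) f by (intro bexI[of _ P]) auto
qed

text \<open>A subword of a word with distinct entries is determined by its set of entries, so the
  target component \<open>v\<close> amounts to the choice of the pipes to be removed.\<close>

lemma subseq_distinct_eq_filter:
  assumes "subseq v w" "distinct w"
  shows "v = filter (\<lambda>x. x \<notin> set w - set v) w"
proof -
  have "v = filter (\<lambda>x. x \<in> set v) w"
    using assms
  proof (induction rule: list_emb.induct)
    case (list_emb_Cons2 x y xs ys)
    then have "filter (\<lambda>z. z \<in> set (x # xs)) ys = filter (\<lambda>z. z \<in> set xs) ys"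
      by (intro filter_cong) auto
    with list_emb_Cons2 show ?case by simp
  qed (auto dest: list_emb_set simp: filter_empty_conv)
  then show ?thesis by (metis (mono_tags, lifting) DiffE DiffI filter_cong)
qed

theorem theorem3p8:
  fixes n :: nat and w :: "nat list"
  assumes "length w = n" and "distinct w" and "set w = {1..n}"
    and "avoids_1423 w"
  shows "bij_betw (Phi w) (MRPD w) {(v, Q). subseq v w \<and> Q \<in> CMRPD v}"
proof -
  define rems where "rems P = sorted_list_of_set {j. removable w P j}" for P
  have Phi: "Phi w P = reduce_all (rems P) w P" for P by (simp add: Phi_def rems_def)
  have sub: "{j. removable w P j} \<subseteq> set w" for P by (auto simp: removable_def)
  then have fin: "finite {j. removable w P j}" for P using finite_subset by blast
  have rems: "set (rems P) = {j. removable w P j}" "distinct (rems P)" for P using fin by (auto simp: rems_def)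
  have reduce: "\<exists>Q. Phi w P = (filter (\<lambda>x. x \<notin> set (rems P)) w, Q) \<and> Q \<in> CMRPD (filter (\<lambda>x. x \<notin> set (rems P)) w)"
    if "P \<in> MRPD w" for P
    using reduce_all_MRPD[OF assms(2) rems(2) that, of P] unfolding Phi CMRPD_def by (auto simp: rems(1))
  have "inj_on (Phi w) (MRPD w)"
  proof (rule inj_onI)
    fix P P' assume P: "P \<in> MRPD w" "P' \<in> MRPD w" and eq: "Phi w P = Phi w P'"
    have "filter (\<lambda>x. x \<notin> set (rems P)) w = filter (\<lambda>x. x \<notin> set (rems P')) w"
      using reduce[OF P(1)] reduce[OF P(2)] eq by auto
    \<comment> \<open>Equal images have equal words, and the entries of \<open>w\<close> missing
      from that word are exactly the removed pipes; so both reductions use the same list.\<close>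
    then have "set w - set (rems P) = set w - set (rems P')" by (metis set_diff_eq set_filter)
    then have "set (rems P) = set (rems P')" using sub[of P] sub[of P'] unfolding rems by blast
    then have same: "rems P' = rems P" unfolding rems by (simp add: rems_def)
    have "\<forall>j\<in>set (rems P). removable w P j" "\<forall>j\<in>set (rems P). removable w P' j"
      using rems(1)[of P] rems(1)[of P'] same by auto
    moreover have "reduce_all (rems P) w P = reduce_all (rems P) w P'" using eq same unfolding Phi by simp
    ultimately show "P = P'" by (rule reduce_all_inj[OF assms(2) rems(2) P(1) _ P(2)])
  qed
  moreover have "Phi w ` MRPD w = {(v, Q). subseq v w \<and> Q \<in> CMRPD v}"
  proof (intro equalityI subsetI)
    fix x assume "x \<in> Phi w ` MRPD w"
    then obtain P where P: "P \<in> MRPD w" "x = Phi w P" by blast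
    show "x \<in> {(v, Q). subseq v w \<and> Q \<in> CMRPD v}" using reduce[OF P(1)] P(2) by auto
  next
    fix x assume "x \<in> {(v, Q). subseq v w \<and> Q \<in> CMRPD v}"
    then obtain v Q where x: "x = (v,Q)" and v: "subseq v w" and Q: "Q \<in> CMRPD v" by blast
    define js where "js = sorted_list_of_set (set w - set v)"
    have js: "set js = set w - set v" "distinct js" by (auto simp: js_def)
    have vf: "v = filter (\<lambda>x. x \<notin> set js) w" using subseq_distinct_eq_filter[OF v assms(2)] js(1) by simp
    have sub: "set js \<subseteq> set w" using js(1) by blast
    have QM: "Q \<in> MRPD (filter (\<lambda>x. x \<notin> set js) w)" using Q unfolding vf[symmetric] CMRPD_def by blast
    obtain P where P: "P \<in> MRPD w" "\<forall>j\<in>set js. removable w P j" "reduce_all js w P = (v, Q)"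
      using reduce_all_surj[OF assms(2,4) js(2) sub QM] unfolding vf[symmetric] by blast
    \<comment> \<open>Since \<open>Q\<close> is core, no pipe outside \<open>js\<close> can be
      removable in \<open>P\<close>. Hence \<open>Phi\<close> removes precisely the inserted pipes,
      in the same sorted order.\<close>
    have "removable v Q j \<longleftrightarrow> removable w P j \<and> j \<notin> set js" for j
      using reduce_all_MRPD[OF assms(2) js(2) P(1,2)] P(3) unfolding vf[symmetric] by auto
    then have "{j. removable w P j} = set js" using Q P(2) unfolding CMRPD_def by blast
    then have "rems P = js" unfolding rems_def js(1) js_def by simp
    then have "Phi w P = x" using P(3) x Phi by simp
    then show "x \<in> Phi w ` MRPD w" using P(1) by blast
  qed
  ultimately show ?thesis by (simp add: bij_betw_def)
qed

end
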